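(* Let $V$ be a locally linearly compact vector space over a discrete field $\mathbb{K}$ and $\phi:V\to V$ a continuous endomorphism. Let $\widehat{V}$ be the Lefschetz dual of $V$ and $\widehat{\phi}:\widehat{V}\to\widehat{V}$ the dual endomorphism of $\phi$. Then $$\mathrm{ent}^*(\phi)=\mathrm{ent}(\widehat{\phi}).$$
   Context: $\mathbb{K}$ is an arbitrary field with the discrete topology. A Hausdorff topological $\mathbb{K}$-vector space is linearly topologized if it has a neighborhood basis at $0$ consisting of linear subspaces. A linear variety is a coset $v+W$ of a linear subspace $W$; it is closed if $W$ is closed. A linearly topologized vector space is linearly compact if every collection of closed linear varieties with the finite intersection property has non-empty intersection. A topological $\mathbb{K}$-vector space $V$ is locally linearly compact if it has a neighborhood basis at $0$ consisting of linearly compact open linear subspaces; $\mathcal{B}(V)$ denotes the set of all linearly compact open linear subspaces of $V$. A continuous endomorphism is a continuous $\mathbb{K}$-linear map $V\to V$. Topological entropy: for a continuous endomorphism $\phi:V\to V$, $U\in\mathcal{B}(V)$ and $n\geq 1$, let $C_n(\phi,U)=U\cap\phi^{-1}U\cap\ldots\cap\phi^{-n+1}U$, $H^*(\phi,U)=\lim_{n\to\infty}\frac{1}{n}\dim\frac{U}{C_n(\phi,U)}$ (this limit exists), and $\mathrm{ent}^*(\phi)=\sup\{H^*(\phi,U)\mid U\in\mathcal{B}(V)\}$. Algebraic entropy: for a continuous endomorphism $\phi:V\to V$, $U\in\mathcal{B}(V)$ and $n\geq 1$, let $T_n(\phi,U)=U+\phi U+\ldots+\phi^{n-1}U$, $H(\phi,U)=\lim_{n\to\infty}\frac{1}{n}\dim\frac{T_n(\phi,U)}{U}$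 (this limit exists), and $\mathrm{ent}(\phi)=\sup\{H(\phi,U)\mid U\in\mathcal{B}(V)\}$. Lefschetz dual: $\widehat{V}$ is the vector space $\mathrm{CHom}(V,\mathbb{K})$ of all continuous linear maps $V\to\mathbb{K}$, with the linear topology having as neighborhood basis at $0$ the family $\{A^\perp\mid A\leq V,\ A\text{ linearly compact}\}$, where $A^\perp=\{\chi\in\mathrm{CHom}(V,\mathbb{K})\mid\chi(A)=0\}$; it is again locally linearly compact. The dual endomorphism $\widehat{\phi}:\widehat{V}\to\widehat{V}$ is $\widehat{\phi}(\chi)=\chi\circ\phi$. *)

theory Defs
  imports
    "HOL-Analysis.Analysis"
    "HOL-Library.Set_Algebras"
    "HOL-Library.Function_Algebras"
begin

text \<open>
  A topological vector space over the discrete field \<open>'k\<close> is given by a scalar multiplication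
  \<open>smul\<close> making an ambient type \<open>'v\<close> a vector space, and a topology \<open>T\<close> whose carrier
  \<open>topspace T\<close> is a linear subspace of \<open>'v\<close>. The carrier need not be all of \<open>'v\<close>, so that
  linear subspaces (as \<open>subtopology T A\<close>) and dual spaces (inside a function type) are objects of
  the same kind.
\<close>

definition topological_vec_space ::
    "('k::field \<Rightarrow> 'v::ab_group_add \<Rightarrow> 'v) \<Rightarrow> 'v topology \<Rightarrow> bool" where
  "topological_vec_space smul T \<longleftrightarrow>
     vector_space smul \<and> module.subspace smul (topspace T) \<and>
     continuous_map (prod_topology T T) T (\<lambda>(x, y). x + y) \<and>
     continuous_map (prod_topology (discrete_topology UNIV) T) T (\<lambda>(c, x). smul c x)"

definition linear_subspace ::
    "('k::field \<Rightarrow> 'v::ab_group_add \<Rightarrow> 'v) \<Rightarrow> 'v topology \<Rightarrow> 'v set \<Rightarrow> bool" where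
  "linear_subspace smul T W \<longleftrightarrow> module.subspace smul W \<and> W \<subseteq> topspace T"

definition nhd_basis_at :: "'v topology \<Rightarrow> 'v \<Rightarrow> 'v set set \<Rightarrow> bool" where
  "nhd_basis_at T x \<N> \<longleftrightarrow>
     (\<forall>N\<in>\<N>. N \<subseteq> topspace T \<and> (\<exists>G. openin T G \<and> x \<in> G \<and> G \<subseteq> N)) \<and>
     (\<forall>G. openin T G \<and> x \<in> G \<longrightarrow> (\<exists>N\<in>\<N>. N \<subseteq> G))"

definition linearly_topologized ::
    "('k::field \<Rightarrow> 'v::ab_group_add \<Rightarrow> 'v) \<Rightarrow> 'v topology \<Rightarrow> bool" where
  "linearly_topologized smul T \<longleftrightarrow>
     topological_vec_space smul T \<and> Hausdorff_space T \<and>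
     (\<exists>\<N>. nhd_basis_at T 0 \<N> \<and> (\<forall>N\<in>\<N>. linear_subspace smul T N))"

definition closed_linear_variety ::
    "('k::field \<Rightarrow> 'v::ab_group_add \<Rightarrow> 'v) \<Rightarrow> 'v topology \<Rightarrow> 'v set \<Rightarrow> bool" where
  "closed_linear_variety smul T F \<longleftrightarrow>
     (\<exists>v\<in>topspace T. \<exists>W. linear_subspace smul T W \<and> closedin T W \<and> F = v +o W)"

definition linearly_compact ::
    "('k::field \<Rightarrow> 'v::ab_group_add \<Rightarrow> 'v) \<Rightarrow> 'v topology \<Rightarrow> bool" where
  "linearly_compact smul T \<longleftrightarrow>
     linearly_topologized smul T \<and>
     (\<forall>\<F>. (\<forall>F\<in>\<F>. closed_linear_variety smul T F) \<and>
           (\<forall>\<G>. \<G> \<subseteq> \<F> \<and> finite \<G> \<longrightarrow> \<Inter>\<G> \<noteq> {}) \<longrightarrow> \<Inter>\<F> \<noteq> {})"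

definition linearly_compact_subspace ::
    "('k::field \<Rightarrow> 'v::ab_group_add \<Rightarrow> 'v) \<Rightarrow> 'v topology \<Rightarrow> 'v set \<Rightarrow> bool" where
  "linearly_compact_subspace smul T A \<longleftrightarrow>
     linear_subspace smul T A \<and> linearly_compact smul (subtopology T A)"

definition lc_open_subspaces ::
    "('k::field \<Rightarrow> 'v::ab_group_add \<Rightarrow> 'v) \<Rightarrow> 'v topology \<Rightarrow> 'v set set" where
  "lc_open_subspaces smul T = {U. linearly_compact_subspace smul T U \<and> openin T U}"

definition locally_linearly_compact ::
    "('k::field \<Rightarrow> 'v::ab_group_add \<Rightarrow> 'v) \<Rightarrow> 'v topology \<Rightarrow> bool" where
  "locally_linearly_compact smul T \<longleftrightarrow>
     topological_vec_space smul T \<and>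
     (\<exists>\<N>. nhd_basis_at T 0 \<N> \<and> \<N> \<subseteq> lc_open_subspaces smul T)"

definition linear_map_on ::
    "'v set \<Rightarrow> ('k::field \<Rightarrow> 'v::ab_group_add \<Rightarrow> 'v) \<Rightarrow> ('k \<Rightarrow> 'w::ab_group_add \<Rightarrow> 'w) \<Rightarrow>
     ('v \<Rightarrow> 'w) \<Rightarrow> bool" where
  "linear_map_on X s1 s2 f \<longleftrightarrow>
     (\<forall>x\<in>X. \<forall>y\<in>X. f (x + y) = f x + f y) \<and> (\<forall>c. \<forall>x\<in>X. f (s1 c x) = s2 c (f x))"

definition continuous_endomorphism ::
    "('k::field \<Rightarrow> 'v::ab_group_add \<Rightarrow> 'v) \<Rightarrow> 'v topology \<Rightarrow> ('v \<Rightarrow> 'v) \<Rightarrow> bool" where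
  "continuous_endomorphism smul T \<phi> \<longleftrightarrow>
     continuous_map T T \<phi> \<and> linear_map_on (topspace T) smul smul \<phi>"


text \<open>
  \<open>B\<close> lifts a finite basis of the quotient \<open>U/W\<close>: every element of \<open>U\<close> is congruent modulo \<open>W\<close>
  to a unique linear combination of \<open>B\<close>. (Two elements of \<open>B\<close> in the same coset of \<open>W\<close> would
  violate uniqueness.)
\<close>

definition quotient_basis ::
    "('k::field \<Rightarrow> 'v::ab_group_add \<Rightarrow> 'v) \<Rightarrow> 'v set \<Rightarrow> 'v set \<Rightarrow> 'v set \<Rightarrow> bool" where
  "quotient_basis smul U W B \<longleftrightarrow>
     finite B \<and> B \<subseteq> U \<and>
     (\<forall>u\<in>U. \<exists>!c. c \<in> B \<rightarrow>\<^sub>E UNIV \<and> u - (\<Sum>b\<in>B. smul (c b) b) \<in> W)"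

definition quotient_dim ::
    "('k::field \<Rightarrow> 'v::ab_group_add \<Rightarrow> 'v) \<Rightarrow> 'v set \<Rightarrow> 'v set \<Rightarrow> enat" where
  "quotient_dim smul U W =
     (if \<exists>B. quotient_basis smul U W B
      then enat (card (SOME B. quotient_basis smul U W B)) else \<infinity>)"


definition cotrajectory ::
    "'v topology \<Rightarrow> ('v \<Rightarrow> 'v) \<Rightarrow> 'v set \<Rightarrow> nat \<Rightarrow> 'v set" where
  "cotrajectory T \<phi> U n = topspace T \<inter> (\<Inter>i<n. (\<phi> ^^ i) -` U)"

definition top_entropy_at ::
    "('k::field \<Rightarrow> 'v::ab_group_add \<Rightarrow> 'v) \<Rightarrow> 'v topology \<Rightarrow> ('v \<Rightarrow> 'v) \<Rightarrow> 'v set \<Rightarrow> ennreal" where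
  "top_entropy_at smul T \<phi> U =
     lim (\<lambda>n. ennreal_of_enat (quotient_dim smul U (cotrajectory T \<phi> U n)) / of_nat n)"

definition top_entropy ::
    "('k::field \<Rightarrow> 'v::ab_group_add \<Rightarrow> 'v) \<Rightarrow> 'v topology \<Rightarrow> ('v \<Rightarrow> 'v) \<Rightarrow> ennreal" where
  "top_entropy smul T \<phi> = (SUP U\<in>lc_open_subspaces smul T. top_entropy_at smul T \<phi> U)"

text \<open>The sum below is the elementwise (Minkowski) sum of sets.\<close>

definition trajectory :: "('v::ab_group_add \<Rightarrow> 'v) \<Rightarrow> 'v set \<Rightarrow> nat \<Rightarrow> 'v set" where
  "trajectory \<phi> U n = (\<Sum>i<n. (\<phi> ^^ i) ` U)"

definition alg_entropy_at ::
    "('k::field \<Rightarrow> 'v::ab_group_add \<Rightarrow> 'v) \<Rightarrow> ('v \<Rightarrow> 'v) \<Rightarrow> 'v set \<Rightarrow> ennreal" where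
  "alg_entropy_at smul \<phi> U =
     lim (\<lambda>n. ennreal_of_enat (quotient_dim smul (trajectory \<phi> U n) U) / of_nat n)"

definition alg_entropy ::
    "('k::field \<Rightarrow> 'v::ab_group_add \<Rightarrow> 'v) \<Rightarrow> 'v topology \<Rightarrow> ('v \<Rightarrow> 'v) \<Rightarrow> ennreal" where
  "alg_entropy smul T \<phi> = (SUP U\<in>lc_open_subspaces smul T. alg_entropy_at smul \<phi> U)"


text \<open>
  Continuous linear functionals on \<open>V\<close> are represented by functions on the ambient type that
  vanish outside the carrier, so that equality and the pointwise operations of the function type
  are those of \<open>CHom(V,K)\<close>.
\<close>

definition CHom ::
    "('k::field \<Rightarrow> 'v::ab_group_add \<Rightarrow> 'v) \<Rightarrow> 'v topology \<Rightarrow> ('v \<Rightarrow> 'k) set" where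
  "CHom smul T =
     {\<xi>. continuous_map T (discrete_topology UNIV) \<xi> \<and>
         linear_map_on (topspace T) smul (*) \<xi> \<and> (\<forall>x. x \<notin> topspace T \<longrightarrow> \<xi> x = 0)}"

definition fun_smul :: "'k::field \<Rightarrow> ('v \<Rightarrow> 'k) \<Rightarrow> 'v \<Rightarrow> 'k" where
  "fun_smul c \<xi> = (\<lambda>x. c * \<xi> x)"

definition annihilator ::
    "('k::field \<Rightarrow> 'v::ab_group_add \<Rightarrow> 'v) \<Rightarrow> 'v topology \<Rightarrow> 'v set \<Rightarrow> ('v \<Rightarrow> 'k) set" where
  "annihilator smul T A = {\<xi> \<in> CHom smul T. \<forall>a\<in>A. \<xi> a = 0}"

text \<open>
  The linear topology on \<open>CHom(V,K)\<close> with the annihilators of linearly compact subspaces as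
  neighborhood basis at \<open>0\<close>. Its open sets are generated by the cosets of these annihilators; the
  cosets form a base, since the annihilators of \<open>A\<close> and \<open>B\<close> intersect in the annihilator of the
  linearly compact subspace \<open>A + B\<close>.
\<close>

definition dual_topology ::
    "('k::field \<Rightarrow> 'v::ab_group_add \<Rightarrow> 'v) \<Rightarrow> 'v topology \<Rightarrow> ('v \<Rightarrow> 'k) topology" where
  "dual_topology smul T =
     topology_generated_by
       {\<xi> +o annihilator smul T A | \<xi> A. \<xi> \<in> CHom smul T \<and> linearly_compact_subspace smul T A}"

definition dual_endomorphism ::
    "'v topology \<Rightarrow> ('v \<Rightarrow> 'v) \<Rightarrow> ('v \<Rightarrow> 'k::field) \<Rightarrow> 'v \<Rightarrow> 'k" where
  "dual_endomorphism T \<phi> \<xi> = (\<lambda>x. if x \<in> topspace T then \<xi> (\<phi> x) else 0)"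

lemma vector_space_fun_smul: "vector_space (fun_smul :: 'k::field \<Rightarrow> ('v \<Rightarrow> 'k) \<Rightarrow> 'v \<Rightarrow> 'k)"
  by unfold_locales (auto simp: fun_smul_def fun_eq_iff algebra_simps)

end

theory Submission
  imports Defs
begin

text \<open>
  The map \<open>U \<mapsto> U\<^sup>\<bottom>\<close> is a bijection from the linearly compact open subspaces of \<open>V\<close> to those of
  its Lefschetz dual. It turns intersections of open subspaces into sums and the preimage under
  \<open>\<phi>\<close> into the image under the dual endomorphism, so it maps the cotrajectory of \<open>U\<close> to the
  trajectory of \<open>U\<^sup>\<bottom>\<close>. Dual bases give \<open>dim U/C = dim C\<^sup>\<bottom>/U\<^sup>\<bottom>\<close>, so the two entropies
  agree term by term and the existence of the limits is never used.
\<close>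

section \<open>Linear algebra\<close>

text \<open>Two facts carry the argument. A linear functional that vanishes on an open subspace is
  continuous, so \<open>U\<^sup>\<bottom>\<close> is the full algebraic dual of \<open>V/U\<close>:
  values prescribed consistently on a subspace, and equal to 0 on \<open>U\<close>, always extend to
  a continuous functional. Sums, preimages and dual bases are all obtained this way. Conversely, an
  open subspace has finite codimension in a linearly compact one, so comparing two nested linearly
  compact open subspaces involves only finitely many functionals. The obstacle is the bijection,
  since the bidual is never formed. A linearly compact open \<open>W\<close> in the dual contains
  some \<open>A\<^sup>\<bottom>\<close> and is finite-dimensional modulo it; hence it is the
  annihilator of a common kernel in \<open>A\<close> of finitely many functionals, and this kernel
  is open. For the linear compactness of \<open>U\<^sup>\<bottom>\<close>, a closed subspace has to
  be recovered from its common zeros; closedness reduces this to a single subspace that is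
  finite-dimensional over \<open>U\<close>.\<close>

lemma linear_map_onD:
  assumes "linear_map_on X s1 s2 f" "x \<in> X"
  shows "y \<in> X \<Longrightarrow> f (x + y) = f x + f y" "f (s1 c x) = s2 c (f x)"
  using assms by (auto simp: linear_map_on_def)

lemma linear_map_on_subset: "linear_map_on X s1 s2 f \<Longrightarrow> Y \<subseteq> X \<Longrightarrow> linear_map_on Y s1 s2 f"
  unfolding linear_map_on_def by blast

context vector_space
begin

lemma linear_map_on_0:
  fixes f :: "'b \<Rightarrow> 'a"
  assumes "linear_map_on X scale (*) f" "subspace X"
  shows "f 0 = 0"
  using linear_map_onD(2)[OF assms(1), of 0 0] subspace_0[OF assms(2)] by simp

lemma linear_map_on_diff:
  fixes f :: "'b \<Rightarrow> 'a"
  assumes "linear_map_on X scale (*) f" "subspace X" "x \<in> X" "y \<in> X"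
  shows "f (x - y) = f x - f y"
proof -
  have "f ((x - y) + y) = f (x - y) + f y"
    using assms by (intro linear_map_onD(1)[OF assms(1)] subspace_diff)
  then show ?thesis by simp
qed

lemma linear_map_on_eq_span:
  fixes f g :: "'b \<Rightarrow> 'a"
  assumes "linear_map_on X scale (*) f" "linear_map_on X scale (*) g" "subspace X"
    and "S \<subseteq> X" "\<And>x. x \<in> S \<Longrightarrow> f x = g x" "x \<in> span S"
  shows "f x = g x"
proof -
  have "subspace {x \<in> X. f x = g x}"
    using assms(1-3) by (auto simp: subspace_def linear_map_on_def linear_map_on_0)
  then have "span S \<subseteq> {x \<in> X. f x = g x}"
    using assms(4,5) by (intro span_minimal) auto
  with assms(6) show ?thesis by auto
qed

section \<open>Bases and dimension of a quotient\<close>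

lemma quotient_basis_iff:
  assumes "subspace U" "subspace W"
  shows "quotient_basis scale U W B \<longleftrightarrow> finite B \<and> B \<subseteq> U \<and>
     (\<forall>u\<in>U. \<exists>c. u - (\<Sum>b\<in>B. scale (c b) b) \<in> W) \<and>
     (\<forall>c. (\<Sum>b\<in>B. scale (c b) b) \<in> W \<longrightarrow> (\<forall>b\<in>B. c b = 0))"
    (is "?L \<longleftrightarrow> ?R")
proof
  assume L: ?L
  have "c b = 0" if c: "(\<Sum>b\<in>B. scale (c b) b) \<in> W" and b: "b \<in> B" for c b
  proof -
    \<comment> \<open>Since \<open>?u\<close> lies in \<open>W\<close>, both \<open>c\<close> and
      the zero function represent it modulo \<open>W\<close>. Uniqueness speaks of functions
      extensional on \<open>B\<close>, hence the restrictions.\<close>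
    let ?u = "\<Sum>b\<in>B. scale (c b) b"
    have "?u \<in> U"
      using L assms by (auto simp: quotient_basis_def intro!: subspace_sum subspace_scale)
    then have ex: "\<exists>!c. c \<in> B \<rightarrow>\<^sub>E UNIV \<and> ?u - (\<Sum>b\<in>B. scale (c b) b) \<in> W"
      using L by (auto simp: quotient_basis_def)
    have "(\<Sum>b\<in>B. scale (restrict c B b) b) = ?u" "(\<Sum>b\<in>B. scale (restrict (\<lambda>_. 0) B b) b) = 0"
      by (auto intro: sum.cong sum.neutral)
    then have "restrict c B \<in> B \<rightarrow>\<^sub>E UNIV \<and> ?u - (\<Sum>b\<in>B. scale (restrict c B b) b) \<in> W"
      "restrict (\<lambda>_. 0) B \<in> B \<rightarrow>\<^sub>E UNIV \<and> ?u - (\<Sum>b\<in>B. scale (restrict (\<lambda>_. 0) B b) b) \<in> W"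
      using c subspace_0[OF assms(2)] by simp_all
    then have "restrict c B = restrict (\<lambda>_. 0) B" using ex by blast
    with b show ?thesis by (metis restrict_apply')
  qed
  with L show ?R unfolding quotient_basis_def by blast
next
  assume ?R
  then have R: "finite B" "B \<subseteq> U" "\<And>u. u \<in> U \<Longrightarrow> \<exists>c. u - (\<Sum>b\<in>B. scale (c b) b) \<in> W"
    "\<And>c b. (\<Sum>b\<in>B. scale (c b) b) \<in> W \<Longrightarrow> b \<in> B \<Longrightarrow> c b = 0" by auto
  have "\<exists>!c. c \<in> B \<rightarrow>\<^sub>E UNIV \<and> u - (\<Sum>b\<in>B. scale (c b) b) \<in> W" if u: "u \<in> U" for u
  proof -
    obtain c where c: "u - (\<Sum>b\<in>B. scale (c b) b) \<in> W" using R(3)[OF u] by blast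
    have eq: "(\<Sum>b\<in>B. scale (restrict c B b) b) = (\<Sum>b\<in>B. scale (c b) b)"
      by (rule sum.cong) auto
    show ?thesis
    proof (rule ex1I[of _ "restrict c B"])
      show "restrict c B \<in> B \<rightarrow>\<^sub>E UNIV \<and> u - (\<Sum>b\<in>B. scale (restrict c B b) b) \<in> W"
        using c eq by (simp add: restrict_PiE_iff)
    next
      fix d assume d: "d \<in> B \<rightarrow>\<^sub>E UNIV \<and> u - (\<Sum>b\<in>B. scale (d b) b) \<in> W"
      have "(u - (\<Sum>b\<in>B. scale (c b) b)) - (u - (\<Sum>b\<in>B. scale (d b) b)) \<in> W"
        using subspace_diff[OF assms(2) c] d by blast
      then have "(\<Sum>b\<in>B. scale (d b - c b) b) \<in> W"
        by (simp add: scale_left_diff_distrib sum_subtractf)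
      then have "d b = c b" if "b \<in> B" for b using R(4)[of "\<lambda>b. d b - c b" b] that by simp
      with d show "d = restrict c B" by (auto simp: PiE_def extensional_def fun_eq_iff)
    qed
  qed
  with R(1,2) show ?L by (auto simp: quotient_basis_def)
qed

text \<open>Steinitz exchange without forming the quotient space: each \<open>b\<close> is moved
  within its coset of \<open>W\<close> to some \<open>p b\<close> in \<open>span D\<close>. A
  relation between the \<open>p b\<close> is one between the \<open>b\<close> modulo
  \<open>W\<close>, so the \<open>p b\<close> are independent. By symmetry all bases have the same
  size, which makes the choice by \<open>SOME\<close> in \<open>quotient_dim\<close>
  harmless.\<close>

lemma quotient_basis_card_le:
  assumes U: "subspace U" and W: "subspace W"
    and B: "quotient_basis scale U W B" and D: "quotient_basis scale U W D"
  shows "card B \<le> card D"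
proof -
  have B': "finite B" "B \<subseteq> U" and indep: "\<And>c b. (\<Sum>b\<in>B. scale (c b) b) \<in> W \<Longrightarrow> b \<in> B \<Longrightarrow> c b = 0"
    using B by (auto simp: quotient_basis_iff[OF U W])
  have D': "finite D" and gen: "\<And>u. u \<in> U \<Longrightarrow> \<exists>c. u - (\<Sum>b\<in>D. scale (c b) b) \<in> W"
    using D by (auto simp: quotient_basis_iff[OF U W])
  have "\<exists>d. d \<in> span D \<and> b - d \<in> W" if "b \<in> B" for b
  proof -
    obtain c where "b - (\<Sum>d\<in>D. scale (c d) d) \<in> W" using gen[of b] B' \<open>b \<in> B\<close> by blast
    moreover have "(\<Sum>d\<in>D. scale (c d) d) \<in> span D"
      by (intro span_sum span_scale span_base)
    ultimately show ?thesis by blast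
  qed
  then obtain p where p: "\<And>b. b \<in> B \<Longrightarrow> p b \<in> span D" "\<And>b. b \<in> B \<Longrightarrow> b - p b \<in> W" by metis
  have zero: "c b = 0" if s: "(\<Sum>b\<in>B. scale (c b) (p b)) = 0" and b: "b \<in> B" for c b
  proof -
    have "(\<Sum>b\<in>B. scale (c b) (b - p b)) \<in> W"
      using p W by (intro subspace_sum subspace_scale)
    then have "(\<Sum>b\<in>B. scale (c b) b) \<in> W"
      using s by (simp add: scale_right_diff_distrib sum_subtractf)
    then show ?thesis using indep[of c b] b by simp
  qed
  have inj: "inj_on p B"
  proof (rule inj_onI, rule ccontr)
    fix x y assume xy: "x \<in> B" "y \<in> B" "p x = p y" "x \<noteq> y"
    \<comment> \<open>The coefficients of the relation \<open>p x - p y = 0\<close>.\<close>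
    define c where "c = (\<lambda>b. if b = x then 1 else if b = y then -1 else 0 :: 'a)"
    have "(\<Sum>b\<in>B. scale (c b) (p b)) = (\<Sum>b\<in>{x, y}. scale (c b) (p b))"
      using B' xy by (intro sum.mono_neutral_right) (auto simp: c_def)
    also have "\<dots> = 0" using xy by (simp add: c_def)
    finally have "c x = 0" using zero xy by blast
    then show False by (simp add: c_def)
  qed
  have "independent (p ` B)"
  proof (rule ccontr)
    assume "\<not> independent (p ` B)"
    then obtain u where u: "\<exists>v\<in>p ` B. u v \<noteq> 0" "(\<Sum>v\<in>p ` B. scale (u v) v) = 0"
      using B' by (auto simp: dependent_finite)
    then have "(\<Sum>b\<in>B. scale (u (p b)) (p b)) = 0"
      using inj by (simp add: sum.reindex)
    from zero[OF this] u show False by auto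
  qed
  then have "card (p ` B) \<le> card D"
    using independent_span_bound[of D "p ` B"] p D' by blast
  with inj show ?thesis by (simp add: card_image)
qed

lemma quotient_dim_eq:
  assumes "subspace U" "subspace W" "quotient_basis scale U W B"
  shows "quotient_dim scale U W = enat (card B)"
proof -
  have "quotient_basis scale U W (SOME B. quotient_basis scale U W B)"
    using assms(3) by (rule someI)
  with assms have "card (SOME B. quotient_basis scale U W B) = card B"
    by (intro antisym quotient_basis_card_le)
  with assms(3) show ?thesis by (auto simp: quotient_dim_def)
qed

lemma quotient_basis_span:
  assumes "subspace U" "subspace W" "W \<subseteq> U" "quotient_basis scale U W B"
  shows "U = span (W \<union> B)"
proof
  have B: "B \<subseteq> U" "\<And>u. u \<in> U \<Longrightarrow> \<exists>c. u - (\<Sum>b\<in>B. scale (c b) b) \<in> W"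
    using assms(4) by (auto simp: quotient_basis_iff[OF assms(1,2)])
  show "span (W \<union> B) \<subseteq> U" using assms B by (intro span_minimal) auto
  show "U \<subseteq> span (W \<union> B)"
  proof
    fix u assume "u \<in> U"
    then obtain c where c: "u - (\<Sum>b\<in>B. scale (c b) b) \<in> W" using B(2) by blast
    have "(u - (\<Sum>b\<in>B. scale (c b) b)) + (\<Sum>b\<in>B. scale (c b) b) \<in> span (W \<union> B)"
      using c by (intro span_add span_sum span_scale span_base) auto
    then show "u \<in> span (W \<union> B)" by simp
  qed
qed

text \<open>\<open>P\<close> is the graph of a partial functional. With a relation, well-definedness
  has to be checked only at 0: by additivity, two values at \<open>x\<close> differ by a value at 0.
  The total functional is then fixed on a basis of the domain and extended from there.\<close>

lemma linear_relation_extend: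
  fixes P :: "'b \<Rightarrow> 'a \<Rightarrow> bool"
  assumes add: "\<And>x y c d. P x c \<Longrightarrow> P y d \<Longrightarrow> P (x + y) (c + d)"
    and scl: "\<And>a x c. P x c \<Longrightarrow> P (scale a x) (a * c)"
    and zero: "P 0 0" and uniq: "\<And>c. P 0 c \<Longrightarrow> c = 0"
  obtains g where "linear_map_on UNIV scale (*) g" "\<And>x c. P x c \<Longrightarrow> g x = c"
proof -
  interpret K: vector_space "(*) :: 'a \<Rightarrow> 'a \<Rightarrow> 'a"
    by unfold_locales (auto simp: algebra_simps)
  interpret VK: vector_space_pair scale "(*) :: 'a \<Rightarrow> 'a \<Rightarrow> 'a" ..
  have un: "c = d" if "P x c" "P x d" for x c d
    using uniq[of "c - d"] add[OF that(1) scl[OF that(2), of "-1"]] by simp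
  define f where "f x = (THE c. P x c)" for x
  have f: "f x = c" if "P x c" for x c
    unfolding f_def by (rule the_equality[where P = "P x"]) (use that un in auto)
  have S: "subspace {x. \<exists>c. P x c}"
    using zero by (auto simp: subspace_def intro: add scl)
  obtain B where B: "B \<subseteq> {x. \<exists>c. P x c}" "independent B" "{x. \<exists>c. P x c} \<subseteq> span B"
    using maximal_independent_subset by blast
  obtain g where g: "Vector_Spaces.linear scale (*) g" "\<forall>x\<in>B. g x = f x"
    using VK.linear_independent_extend[OF B(2)] by blast
  interpret g: Vector_Spaces.linear scale "(*)" g by fact
  have lin: "linear_map_on UNIV scale (*) g"
    by (auto simp: linear_map_on_def g.add g.scale)
  have "linear_map_on {x. \<exists>c. P x c} scale (*) f"
    unfolding linear_map_on_def using f[OF add] f[OF scl] f by auto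
  then have "g x = c" if "P x c" for x c
    using linear_map_on_eq_span[OF linear_map_on_subset[OF lin subset_UNIV] _ S B(1), of f x] B(3) g(2) f that
    by auto
  with lin that show ?thesis by blast
qed

end

interpretation functional: vector_space fun_smul
  by (rule vector_space_fun_smul)

context vector_space
begin

text \<open>The induction on \<open>card B\<close> cuts the domain down to the kernel of one functional of \<open>\<W>\<close>.\<close>

lemma functional_eq_on_finite_extension:
  fixes \<W> :: "('b \<Rightarrow> 'a) set" and \<xi> :: "'b \<Rightarrow> 'a"
  assumes "finite B" and W: "functional.subspace \<W>"
    and "\<And>w. w \<in> \<W> \<Longrightarrow> linear_map_on (span (U \<union> B)) scale (*) w"
    and "\<And>w u. w \<in> \<W> \<Longrightarrow> u \<in> U \<Longrightarrow> w u = 0"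
    and "linear_map_on (span (U \<union> B)) scale (*) \<xi>" "\<And>u. u \<in> U \<Longrightarrow> \<xi> u = 0"
    and "\<And>x. x \<in> span (U \<union> B) \<Longrightarrow> (\<And>w. w \<in> \<W> \<Longrightarrow> w x = 0) \<Longrightarrow> \<xi> x = 0"
  shows "\<exists>w\<in>\<W>. \<forall>x\<in>span (U \<union> B). w x = \<xi> x"
  using assms(1,3-)
proof (induction "card B" arbitrary: B rule: less_induct)
  case (less B)
  let ?A = "span (U \<union> B)"
  show ?case
  proof (cases "\<exists>w\<in>\<W>. \<exists>b\<in>B. w b \<noteq> 0")
    \<comment> \<open>All of \<open>\<W>\<close> vanishes on \<open>span (U \<union> B)\<close>, so
      the last assumption makes \<open>\<xi>\<close> vanish there too, and 0 is the required member
      of \<open>\<W>\<close>.\<close>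
    case False
    have "w x = 0" if "w \<in> \<W>" "x \<in> ?A" for w x
      using linear_map_on_eq_span[OF less.prems(2)[OF that(1)], of "\<lambda>_. 0" "U \<union> B" x] False that
        less.prems(3) span_superset[of "U \<union> B"]
      by (fastforce simp: linear_map_on_def)
    then show ?thesis
      using less.prems(6) functional.subspace_0[OF W] by (metis zero_fun_apply)
  next
    case True
    then obtain w0 b where w0: "w0 \<in> \<W>" "b \<in> B" "w0 b \<noteq> 0" by blast
    note lw0 = less.prems(2)[OF w0(1)]
    \<comment> \<open>\<open>p\<close> is the projection along \<open>b\<close> onto the kernel of
      \<open>w0\<close>. It fixes \<open>U\<close>, where \<open>w0\<close> vanishes, and kills
      \<open>b\<close>, so fewer than \<open>card B\<close> further generators remain.\<close>
    define p where "p x = x - scale (w0 x / w0 b) b" for x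
    define B' where "B' = p ` (B - {b})"
    let ?A' = "span (U \<union> B')"
    have bA: "b \<in> ?A" using w0 by (auto intro: span_base)
    have p_add: "p (x + y) = p x + p y" if "x \<in> ?A" "y \<in> ?A" for x y
      using linear_map_onD(1)[OF lw0 that]
      by (simp add: p_def algebra_simps add_divide_distrib)
    have p_scl: "p (scale c x) = scale c (p x)" if "x \<in> ?A" for c x
      using linear_map_onD(2)[OF lw0 that]
      by (simp add: p_def algebra_simps)
    have pb: "p b = 0" using w0 by (simp add: p_def)
    have p0: "p 0 = 0" using lw0 by (simp add: p_def linear_map_on_0)
    have pU: "p u = u" if "u \<in> U" for u using less.prems(3)[OF w0(1) that] by (simp add: p_def)
    have pA: "p x \<in> ?A'" if "x \<in> ?A" for x
    proof -
      have "subspace {x \<in> ?A. p x \<in> ?A'}"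
        using p_add p_scl p0 by (auto simp: subspace_def span_zero span_add span_scale)
      moreover have "U \<union> B \<subseteq> {x \<in> ?A. p x \<in> ?A'}"
      proof (intro subsetI CollectI conjI)
        fix x assume x: "x \<in> U \<union> B"
        then show "x \<in> ?A" by (rule span_base)
        show "p x \<in> ?A'"
        proof (cases "x \<in> U \<or> x = b")
          case True
          then show ?thesis using pb pU[of x] by (auto simp: span_zero intro: span_base)
        next
          case False
          with x have "p x \<in> B'" by (auto simp: B'_def)
          then show ?thesis by (intro span_base) simp
        qed
      qed
      ultimately show ?thesis using span_minimal that by blast
    qed
    have A'A: "?A' \<subseteq> ?A"
    proof (rule span_minimal)
      show "U \<union> B' \<subseteq> ?A"
        using bA by (auto simp: B'_def p_def intro!: span_diff span_scale intro: span_base)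
    qed simp
    have ker: "w0 x = 0" if "x \<in> ?A'" for x
    proof -
      have "w0 y = 0" if "y \<in> U \<union> B'" for y
        using that less.prems(3)[OF w0(1)] w0(3) bA
        by (auto simp: B'_def p_def linear_map_on_diff[OF lw0] linear_map_onD(2)[OF lw0]
            span_base span_scale)
      then show ?thesis
        using linear_map_on_eq_span[OF lw0, of "\<lambda>_. 0" "U \<union> B'" x] that A'A
          span_superset[of "U \<union> B'"]
        by (auto simp: linear_map_on_def)
    qed
    have px: "p x = x" if "x \<in> ?A'" for x using ker[OF that] by (simp add: p_def)
    have "card B' \<le> card (B - {b})" unfolding B'_def by (rule card_image_le) (use less.prems in auto)
    also have "\<dots> < card B" using w0 less.prems(1) by (intro psubset_card_mono) auto
    finally have "\<exists>w\<in>\<W>. \<forall>x\<in>?A'. w x = \<xi> x"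
      using less.prems A'A
      by (intro less.hyps) (auto simp: B'_def intro: linear_map_on_subset)
    then obtain w where w: "w \<in> \<W>" "\<And>x. x \<in> ?A' \<Longrightarrow> w x = \<xi> x" by blast
    \<comment> \<open>A multiple of \<open>w0\<close> does not change the values on
      \<open>?A'\<close>; this one corrects the value at \<open>b\<close>, the only direction
      missing from \<open>?A'\<close>.\<close>
    define c where "c = (\<xi> b - w b) / w0 b"
    show ?thesis
    proof (intro bexI ballI)
      show "w + fun_smul c w0 \<in> \<W>"
        using W w w0 by (intro functional.subspace_add functional.subspace_scale)
      fix x assume x: "x \<in> ?A"
      have eq: "x = p x + scale (w0 x / w0 b) b" by (simp add: p_def)
      have "f x = f (p x) + (w0 x / w0 b) * f b" if "linear_map_on ?A scale (*) f"
        for f :: "'b \<Rightarrow> 'a"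
        using that pA[OF x] A'A bA
        by (subst eq) (auto simp: linear_map_onD[OF that] subsetD span_scale)
      from this[OF less.prems(4)] this[OF less.prems(2)[OF w(1)]] w(2)[OF pA[OF x]]
      show "(w + fun_smul c w0) x = \<xi> x"
        using w0(3) by (simp add: fun_smul_def c_def field_simps)
    qed
  qed
qed

end

section \<open>Linear topologies\<close>

locale top_vec_space = vector_space scale
  for scale :: "'a::field \<Rightarrow> 'b::ab_group_add \<Rightarrow> 'b" (infixr \<open>\<cdot>\<close> 75) +
  fixes T :: "'b topology"
  assumes tvs: "topological_vec_space scale T"
begin

lemma subspace_topspace: "subspace (topspace T)"
  using tvs by (simp add: topological_vec_space_def)

section \<open>Translations, open subspaces and subtopologies\<close>

lemma continuous_translation:
  assumes "a \<in> topspace T"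
  shows "continuous_map T T (\<lambda>x. a + x)"
proof -
  have "continuous_map T (prod_topology T T) (\<lambda>x. (a, x))"
    using assms by (intro continuous_map_pairedI) auto
  moreover have "continuous_map (prod_topology T T) T (\<lambda>(x, y). x + y)"
    using tvs by (simp add: topological_vec_space_def)
  ultimately show ?thesis
    by (auto dest: continuous_map_compose simp: o_def)
qed

lemma coset_eq_preimage:
  assumes "a \<in> topspace T" "W \<subseteq> topspace T"
  shows "a +o W = {x \<in> topspace T. - a + x \<in> W}"
proof (intro set_eqI iffI)
  fix x assume "x \<in> a +o W"
  then show "x \<in> {x \<in> topspace T. - a + x \<in> W}"
    using assms subspace_topspace by (auto simp: elt_set_plus_def subspace_def)
next
  fix x assume "x \<in> {x \<in> topspace T. - a + x \<in> W}"
  then show "x \<in> a +o W" by (auto simp: elt_set_plus_def intro: bexI[of _ "- a + x"])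
qed

lemma neg_topspace: "a \<in> topspace T \<Longrightarrow> - a \<in> topspace T"
  using subspace_topspace by (rule subspace_neg)

lemma openin_coset:
  assumes "openin T W" "a \<in> topspace T"
  shows "openin T (a +o W)"
  unfolding coset_eq_preimage[OF assms(2) openin_subset[OF assms(1)]]
  using continuous_translation[OF neg_topspace[OF assms(2)]] assms(1)
  by (rule openin_continuous_map_preimage)

text \<open>\<open>S\<close> is the union of the open cosets \<open>x + W\<close> with
  \<open>x\<close> in \<open>S\<close>.\<close>

lemma openin_superspace:
  assumes "subspace S" "S \<subseteq> topspace T" "openin T W" "0 \<in> W" "W \<subseteq> S"
  shows "openin T S"
proof (subst openin_subopen, intro ballI)
  fix x assume "x \<in> S"
  then show "\<exists>G. openin T G \<and> x \<in> G \<and> G \<subseteq> S"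
    using assms openin_coset[of W x]
    by (intro exI[of _ "x +o W"]) (auto simp: elt_set_plus_def intro: subspace_add)
qed

text \<open>The complement is a union of cosets of \<open>W\<close>, each of them open.\<close>

lemma open_subspace_closed:
  assumes "subspace W" "openin T W"
  shows "closedin T W"
proof -
  note sub = openin_subset[OF assms(2)]
  have "openin T (topspace T - W)"
  proof (subst openin_subopen, intro ballI)
    fix x assume x: "x \<in> topspace T - W"
    have "x +o W \<subseteq> topspace T - W"
    proof
      fix y assume "y \<in> x +o W"
      then obtain w where w: "w \<in> W" "y = x + w" by (auto simp: elt_set_plus_def)
      then have "y \<in> topspace T" using x sub subspace_topspace by (auto intro: subspace_add)
      moreover have "y \<notin> W"
        using x subspace_diff[OF assms(1) _ w(1), of y] w by auto
      ultimately show "y \<in> topspace T - W" by simp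
    qed
    then show "\<exists>G. openin T G \<and> x \<in> G \<and> G \<subseteq> topspace T - W"
      using assms x openin_coset[of W x] subspace_0
      by (intro exI[of _ "x +o W"]) (auto simp: elt_set_plus_def)
  qed
  with sub show ?thesis by (simp add: closedin_def)
qed

lemma top_vec_space_subtopology:
  assumes "linear_subspace scale T A"
  shows "top_vec_space scale (subtopology T A)"
proof unfold_locales
  have A: "subspace A" "A \<subseteq> topspace T" using assms by (auto simp: linear_subspace_def)
  have "continuous_map (prod_topology T T) T (\<lambda>(x, y). x + y)"
    and "continuous_map (prod_topology (discrete_topology UNIV) T) T (\<lambda>(c, x). scale c x)"
    using tvs by (auto simp: topological_vec_space_def)
  then have
    "continuous_map (prod_topology (subtopology T A) (subtopology T A)) (subtopology T A) (\<lambda>(x, y). x + y)"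
    "continuous_map (prod_topology (discrete_topology UNIV) (subtopology T A)) (subtopology T A)
       (\<lambda>(c, x). scale c x)"
    using A by (auto simp: continuous_map_in_subtopology prod_topology_subtopology
        intro!: continuous_map_from_subtopology intro: subspace_add subspace_scale)
  with A show "topological_vec_space scale (subtopology T A)"
    by (auto simp: topological_vec_space_def vector_space_axioms Int_absorb1)
qed

lemma linearly_topologized_subtopology:
  assumes "linearly_topologized scale T" "linear_subspace scale T A"
  shows "linearly_topologized scale (subtopology T A)"
proof -
  interpret A: top_vec_space scale "subtopology T A"
    using assms(2) by (rule top_vec_space_subtopology)
  have A: "subspace A" "A \<subseteq> topspace T" using assms by (auto simp: linear_subspace_def)
  obtain \<N> where N: "nhd_basis_at T 0 \<N>" "\<forall>N\<in>\<N>. linear_subspace scale T N"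
    using assms by (auto simp: linearly_topologized_def)
  have "nhd_basis_at (subtopology T A) 0 ((\<lambda>N. N \<inter> A) ` \<N>)"
    unfolding nhd_basis_at_def
  proof (intro conjI ballI allI impI)
    fix M assume "M \<in> (\<lambda>N. N \<inter> A) ` \<N>"
    then obtain N where M: "M = N \<inter> A" "N \<in> \<N>" by blast
    then obtain G where "openin T G" "0 \<in> G" "G \<subseteq> N" using N(1) by (auto simp: nhd_basis_at_def)
    then show "\<exists>G. openin (subtopology T A) G \<and> 0 \<in> G \<and> G \<subseteq> M"
      using M subspace_0[OF A(1)] by (intro exI[of _ "G \<inter> A"]) (auto simp: openin_subtopology)
    show "M \<subseteq> topspace (subtopology T A)" using M A(2) by auto
  next
    fix G assume "openin (subtopology T A) G \<and> 0 \<in> G"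
    then obtain G' where "openin T G'" "0 \<in> G'" "G = G' \<inter> A" by (auto simp: openin_subtopology)
    moreover from this obtain N where "N \<in> \<N>" "N \<subseteq> G'" using N(1) by (auto simp: nhd_basis_at_def)
    ultimately show "\<exists>M\<in>(\<lambda>N. N \<inter> A) ` \<N>. M \<subseteq> G" by (intro bexI[of _ "N \<inter> A"]) auto
  qed
  moreover have "\<forall>M\<in>(\<lambda>N. N \<inter> A) ` \<N>. linear_subspace scale (subtopology T A) M"
    using N(2) A by (auto simp: linear_subspace_def intro: subspace_inter)
  moreover have "Hausdorff_space (subtopology T A)"
    using assms(1) by (auto simp: linearly_topologized_def intro: Hausdorff_space_subtopology)
  ultimately show ?thesis
    unfolding linearly_topologized_def using A.tvs by blast
qed

section \<open>Linearly compact subspaces\<close>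

lemma linearly_compact_subspace_meets:
  assumes U: "linearly_compact_subspace scale T U" and v: "v \<in> topspace T"
    and \<F>: "\<And>F. F \<in> \<F> \<Longrightarrow> closed_linear_variety scale T F"
    and fip: "\<And>\<G>. finite \<G> \<Longrightarrow> \<G> \<subseteq> \<F> \<Longrightarrow> (v +o U) \<inter> \<Inter>\<G> \<noteq> {}"
  shows "(v +o U) \<inter> \<Inter>\<F> \<noteq> {}"
proof -
  have U': "subspace U" "U \<subseteq> topspace T"
    using U by (auto simp: linearly_compact_subspace_def linear_subspace_def)
  \<comment> \<open>Pulling the family back along \<open>u \<mapsto> v + u\<close> reduces the claim
    to the linear compactness of \<open>U\<close>. Since \<open>v + U\<close> meets
    \<open>F\<close>, the pullback is nonempty and therefore a coset
    \<open>u0 + (W \<inter> U)\<close>.\<close>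
  define p where "p F = {u \<in> U. v + u \<in> F}" for F
  have "closed_linear_variety scale (subtopology T U) (p F)" if FF: "F \<in> \<F>" for F
  proof -
    obtain a W where F: "subspace W" "closedin T W" "F = a +o W"
      using \<F>[OF FF] by (auto simp: closed_linear_variety_def linear_subspace_def)
    obtain u0 where u0: "u0 \<in> U" "v + u0 \<in> F"
      using fip[of "{F}"] FF by (auto simp: elt_set_plus_def)
    have "p F = u0 +o (W \<inter> U)"
    proof (intro set_eqI iffI)
      fix u assume "u \<in> p F"
      then have "u \<in> U" "v + u - a \<in> W" "v + u0 - a \<in> W"
        using u0 F by (auto simp: p_def set_minus_plus)
      then have "u - u0 \<in> W \<inter> U"
        using u0 subspace_diff[OF F(1), of "v + u - a" "v + u0 - a"] subspace_diff[OF U'(1)] by simp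
      then show "u \<in> u0 +o (W \<inter> U)" by (rule set_minus_imp_plus)
    next
      fix u assume "u \<in> u0 +o (W \<inter> U)"
      then obtain w where w: "u = u0 + w" "w \<in> W" "w \<in> U" by (auto simp: elt_set_plus_def)
      have "v + u0 - a \<in> W" using u0 F by (simp add: set_minus_plus)
      then have "v + u - a \<in> W" using w subspace_add[OF F(1), of "v + u0 - a" w] by (simp add: algebra_simps)
      then show "u \<in> p F" using w u0 F subspace_add[OF U'(1)] by (auto simp: p_def set_minus_plus)
    qed
    then show ?thesis
      unfolding closed_linear_variety_def linear_subspace_def
      using u0 F U' by (intro bexI[of _ u0] exI[of _ "W \<inter> U"])
        (auto simp: closedin_subtopology intro: subspace_inter)
  qed
  moreover have "\<Inter>\<G> \<noteq> {}" if "\<G> \<subseteq> p ` \<F>" "finite \<G>" for \<G>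
  proof -
    obtain \<G>' where G: "\<G>' \<subseteq> \<F>" "finite \<G>'" "\<G> = p ` \<G>'"
      using \<open>\<G> \<subseteq> p ` \<F>\<close> \<open>finite \<G>\<close> finite_subset_image by metis
    obtain y where "y \<in> v +o U" "y \<in> \<Inter>\<G>'" using fip[OF G(2,1)] by blast
    then show ?thesis using G(3) by (auto simp: elt_set_plus_def p_def)
  qed
  ultimately have ne: "\<Inter>(p ` \<F>) \<noteq> {}"
    using U unfolding linearly_compact_subspace_def linearly_compact_def by (metis (no_types, lifting) image_iff)
  show ?thesis
  proof (cases "\<F> = {}")
    \<comment> \<open>The intersection of the empty family is \<open>UNIV\<close>, so a point of
      \<open>v + U\<close> is supplied directly.\<close>
    case True
    then show ?thesis using subspace_0[OF U'(1)] by (auto simp: elt_set_plus_def)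
  next
    case False
    from ne obtain u where "\<And>F. F \<in> \<F> \<Longrightarrow> u \<in> p F" by blast
    with False have "v + u \<in> (v +o U) \<inter> \<Inter>\<F>" by (auto simp: p_def elt_set_plus_def)
    then show ?thesis by blast
  qed
qed

text \<open>The differences of points of a variety form a subspace, so the line through two points
  stays inside. In \<open>U + Kx\<close> this forces a variety with points in two cosets of
  \<open>U\<close> to meet all of them.\<close>

lemma closed_linear_variety_affine:
  assumes "closed_linear_variety scale T F" "x \<in> F" "y \<in> F"
  shows "x + t \<cdot> (y - x) \<in> F"
proof -
  obtain a W where F: "subspace W" "F = a +o W"
    using assms(1) by (auto simp: closed_linear_variety_def linear_subspace_def)
  with assms have "x - a \<in> W" "y - a \<in> W" by (auto simp: set_minus_plus)
  then have "(x - a) + t \<cdot> ((y - a) - (x - a)) \<in> W"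
    using F(1) by (blast intro: subspace_add subspace_scale subspace_diff)
  then show ?thesis unfolding F(2) set_minus_plus[symmetric] by (simp add: algebra_simps)
qed

lemma linearly_compact_subspace_trans:
  assumes "linearly_compact_subspace scale T U" "U \<subseteq> X"
  shows "linearly_compact_subspace scale (subtopology T X) U"
  using assms by (auto simp: linearly_compact_subspace_def linear_subspace_def subtopology_subtopology Int_absorb1)

text \<open>A family of varieties with the finite intersection property in \<open>U + Kx\<close> either has a finite
  intersection inside a single coset \<open>c x + U\<close>, or all its finite intersections meet every such coset.\<close>

lemma linearly_compact_subspace_insert:
  assumes T: "linearly_topologized scale T" and U: "linearly_compact_subspace scale T U"
    and x: "x \<in> topspace T"
  shows "linearly_compact_subspace scale T (span (insert x U))"
proof -
  let ?X = "span (insert x U)"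
  have U': "subspace U" "U \<subseteq> topspace T"
    using U by (auto simp: linearly_compact_subspace_def linear_subspace_def)
  have "?X \<subseteq> topspace T" using U' x subspace_topspace by (intro span_minimal) auto
  then have X: "linear_subspace scale T ?X" by (simp add: linear_subspace_def)
  then have tX: "topspace (subtopology T ?X) = ?X" by (auto simp: linear_subspace_def)
  interpret X: top_vec_space scale "subtopology T ?X"
    using X by (rule top_vec_space_subtopology)
  have UX: "linearly_compact_subspace scale (subtopology T ?X) U"
    using U by (rule linearly_compact_subspace_trans) (auto intro: span_base)
  have decomp: "\<exists>c. y \<in> c \<cdot> x +o U" if "y \<in> ?X" for y
    using that U' by (auto simp: span_insert span_eq_iff[THEN iffD2] set_minus_plus)
  have cx: "c \<cdot> x \<in> topspace (subtopology T ?X)" for c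
    unfolding tX by (auto intro: span_scale span_base)
  have "\<Inter>\<F> \<noteq> {}" if \<F>: "\<forall>F\<in>\<F>. closed_linear_variety scale (subtopology T ?X) F"
    and fip: "\<forall>\<G>. \<G> \<subseteq> \<F> \<and> finite \<G> \<longrightarrow> \<Inter>\<G> \<noteq> {}" for \<F>
  proof -
    have "\<exists>c. \<forall>\<G>. finite \<G> \<longrightarrow> \<G> \<subseteq> \<F> \<longrightarrow> (c \<cdot> x +o U) \<inter> \<Inter>\<G> \<noteq> {}"
    proof (cases "\<exists>\<G> c. finite \<G> \<and> \<G> \<subseteq> \<F> \<and> (c \<cdot> x +o U) \<inter> \<Inter>\<G> = {}")
      case False
      then show ?thesis by blast
    next
      case True
      then obtain \<G> c where G: "finite \<G>" "\<G> \<subseteq> \<F>" and c: "(c \<cdot> x +o U) \<inter> \<Inter>\<G> = {}" by blast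
      \<comment> \<open>An empty \<open>\<G>\<close> would have intersection \<open>UNIV\<close>,
        which \<open>decomp\<close> does not cover.\<close>
      have "\<G> \<noteq> {}" using c subspace_0[OF U'(1)] by (auto simp: elt_set_plus_def)
      then have sub: "\<Inter>\<G> \<subseteq> ?X"
        using G \<F> X.subspace_topspace closedin_subset unfolding tX
        by (fastforce simp: closed_linear_variety_def elt_set_plus_def linear_subspace_def tX
            intro: span_add)
      obtain y where y: "y \<in> \<Inter>\<G>" using fip G by blast
      then obtain c0 where c0: "y \<in> c0 \<cdot> x +o U" using sub decomp by blast
      have in_c0: "z \<in> c0 \<cdot> x +o U" if z: "z \<in> \<Inter>\<G>" for z
      proof (rule ccontr)
        assume nz: "z \<notin> c0 \<cdot> x +o U"
        obtain c1 where c1: "z \<in> c1 \<cdot> x +o U" using sub decomp z by blast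
        with nz have ne: "c1 \<noteq> c0" by auto
        \<comment> \<open>The parameter at which the line from \<open>y\<close> to \<open>z\<close>
          reaches \<open>c \<cdot> x + U\<close>, the coset missed by
          \<open>\<Inter>\<G>\<close>.\<close>
        define t where "t = (c - c0) / (c1 - c0)"
        have t: "t * (c1 - c0) = c - c0" using ne by (simp add: t_def)
        let ?u = "(y - c0 \<cdot> x) + t \<cdot> ((z - c1 \<cdot> x) - (y - c0 \<cdot> x))"
        have "?u \<in> U"
          using c0 c1 U'(1) unfolding set_minus_plus[symmetric]
            by (blast intro: subspace_add subspace_scale subspace_diff)
        moreover have "?u = (y + t \<cdot> (z - y)) - (c0 + t * (c1 - c0)) \<cdot> x"
          by (simp add: algebra_simps)
        ultimately have "y + t \<cdot> (z - y) \<in> c \<cdot> x +o U"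
          unfolding t by (simp add: set_minus_plus)
        moreover have "y + t \<cdot> (z - y) \<in> \<Inter>\<G>"
          using y z G \<F> X.closed_linear_variety_affine by blast
        ultimately show False using c by blast
      qed
      show ?thesis
      proof (intro exI allI impI)
        \<comment> \<open>Adjoining \<open>\<G>\<close> to \<open>\<H>\<close> confines the common
          points to the coset of \<open>c0 \<cdot> x\<close>.\<close>
        fix \<H> assume H: "finite \<H>" "\<H> \<subseteq> \<F>"
        then have "\<Inter>(\<G> \<union> \<H>) \<noteq> {}" using G fip by (metis Un_subset_iff finite_UnI)
        then show "(c0 \<cdot> x +o U) \<inter> \<Inter>\<H> \<noteq> {}" using in_c0 by blast
      qed
    qed
    then obtain c where c: "\<And>\<G>. finite \<G> \<Longrightarrow> \<G> \<subseteq> \<F> \<Longrightarrow> (c \<cdot> x +o U) \<inter> \<Inter>\<G> \<noteq> {}" by blast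
    have "(c \<cdot> x +o U) \<inter> \<Inter>\<F> \<noteq> {}"
      by (rule X.linearly_compact_subspace_meets[OF UX cx bspec[OF \<F>] c])
    then show ?thesis by blast
  qed
  with X linearly_topologized_subtopology[OF T X] show ?thesis
    unfolding linearly_compact_subspace_def linearly_compact_def by blast
qed

lemma linearly_compact_subspace_span_Un:
  assumes "linearly_topologized scale T" "linearly_compact_subspace scale T U"
    and "finite F" "F \<subseteq> topspace T"
  shows "linearly_compact_subspace scale T (span (U \<union> F))"
  using assms(3,4)
proof (induction F)
  case empty
  then show ?case
    using assms(2) by (simp add: linearly_compact_subspace_def linear_subspace_def span_eq_iff[THEN iffD2])
next
  case (insert x F)
  have "span (insert x (span (U \<union> F))) = span (U \<union> insert x F)"
    by (auto simp: span_insert span_span)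
  with insert linearly_compact_subspace_insert[OF assms(1), of "span (U \<union> F)" x] show ?case by simp
qed

text \<open>Let \<open>D\<close> complete a basis of \<open>W\<close> to one of the carrier. For
  \<open>b\<close> in \<open>D\<close>, the vectors with coordinate 1 at \<open>b\<close> form a
  closed variety. Finitely many of these varieties always meet, so all of them do; but a vector has
  only finitely many nonzero coordinates, hence \<open>D\<close> is finite.\<close>

lemma linearly_compact_quotient_basis:
  assumes lc: "linearly_compact scale T" and W: "subspace W" "openin T W"
  obtains B where "quotient_basis scale (topspace T) W B"
proof -
  note sub = openin_subset[OF W(2)]
  obtain B0 where B0: "B0 \<subseteq> W" "independent B0" "W \<subseteq> span B0"
    using maximal_independent_subset by blast
  obtain B where B: "B0 \<subseteq> B" "B \<subseteq> topspace T" "independent B" "topspace T \<subseteq> span B"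
    using maximal_independent_subset_extend[of B0 "topspace T"] B0 sub by blast
  have spB0: "span B0 = W" using B0 W by (simp add: span_minimal subset_antisym)
  have spB: "span B = topspace T" using B subspace_topspace by (simp add: span_minimal subset_antisym)
  define D where "D = B - B0"
  let ?r = "representation B"
  have r0: "?r w b = 0" if "w \<in> W" "b \<in> D" for w b
  proof -
    have "?r w = representation B0 w"
      using that B0 B by (intro representation_extend) auto
    then show ?thesis using that representation_ne_zero[of B0 w b] by (auto simp: D_def)
  qed
  \<comment> \<open>For \<open>b\<close> in \<open>D\<close> this hyperplane contains the open
    \<open>W\<close>, so it is open and therefore closed.\<close>
  define H where "H b = {x \<in> topspace T. ?r x b = 0}" for b
  have H: "subspace (H b)" for b
    using subspace_topspace spB B(3)
    by (auto simp: H_def subspace_def representation_zero representation_add representation_scale)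
  have "closedin T (H b)" if "b \<in> D" for b
    by (rule open_subspace_closed[OF H], rule openin_superspace[OF H _ W(2)])
      (use W r0 sub that in \<open>auto simp: H_def intro: subspace_0\<close>)
  moreover have DT: "D \<subseteq> topspace T" using B by (auto simp: D_def)
  ultimately have cl: "\<forall>F\<in>(\<lambda>b. b +o H b) ` D. closed_linear_variety scale T F"
    using H by (force simp: closed_linear_variety_def linear_subspace_def H_def)
  have coset: "x \<in> b +o H b \<longleftrightarrow> x \<in> topspace T \<and> ?r x b = 1" if "b \<in> D" for x b
  proof -
    have b: "b \<in> topspace T" "?r b b = 1"
      using that DT B(3) by (auto simp: D_def representation_basis)
    have "x - b \<in> topspace T \<longleftrightarrow> x \<in> topspace T"
      using subspace_topspace b(1) by (metis diff_add_cancel subspace_add subspace_diff)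
    moreover have "?r (x - b) b = ?r x b - 1" if "x \<in> topspace T"
      using that b spB B(3) by (simp add: representation_diff)
    ultimately show ?thesis by (auto simp: set_minus_plus[symmetric] H_def)
  qed
  have fip: "\<Inter>\<G> \<noteq> {}" if G: "\<G> \<subseteq> (\<lambda>b. b +o H b) ` D" "finite \<G>" for \<G>
  proof -
    obtain E where E: "E \<subseteq> D" "finite E" "\<G> = (\<lambda>b. b +o H b) ` E"
      using finite_subset_image[OF G(2,1)] by blast
    \<comment> \<open>The sum of the basis vectors in \<open>E\<close> is the common point of the
      finite subfamily.\<close>
    have "?r (\<Sum>E) b = 1" if "b \<in> E" for b
    proof -
      have "?r (\<Sum>E) b = (\<Sum>e\<in>E. ?r e b)"
        using E B D_def by (subst representation_sum[where v = "\<lambda>e. e"]) (auto intro: span_base)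
      also have "\<dots> = (\<Sum>e\<in>E. if e = b then 1 else 0)"
        using E B by (intro sum.cong) (auto simp: D_def representation_basis)
      finally show ?thesis using that E by simp
    qed
    moreover have "\<Sum>E \<in> topspace T" using E DT subspace_topspace by (intro subspace_sum) auto
    ultimately have "\<Sum>E \<in> \<Inter>\<G>" using E coset by auto
    then show ?thesis by blast
  qed
  have "\<Inter>((\<lambda>b. b +o H b) ` D) \<noteq> {}"
    using lc cl fip by (simp add: linearly_compact_def)
  then obtain x where x: "\<And>b. b \<in> D \<Longrightarrow> x \<in> b +o H b" by blast
  have "D \<subseteq> {b. ?r x b \<noteq> 0}" using x coset by auto
  then have fD: "finite D" using finite_representation finite_subset by blast
  have "\<exists>c. u - (\<Sum>b\<in>D. c b \<cdot> b) \<in> W" if "u \<in> topspace T" for u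
  proof -
    have "u \<in> span (B0 \<union> D)" using that spB B(1) by (simp add: D_def Un_absorb1)
    then obtain w d where "u = w + d" "w \<in> W" "d \<in> span D" by (auto simp: span_Un spB0)
    moreover from this obtain c where "d = (\<Sum>b\<in>D. c b \<cdot> b)" using fD by (auto simp: span_finite)
    ultimately show ?thesis by (intro exI[of _ c]) simp
  qed
  moreover have "c b = 0" if c: "(\<Sum>b\<in>D. c b \<cdot> b) \<in> W" and b: "b \<in> D" for c b
  proof -
    have "?r (\<Sum>d\<in>D. c d \<cdot> d) b = (\<Sum>d\<in>D. ?r (c d \<cdot> d) b)"
      using B D_def by (subst representation_sum) (auto intro: span_base span_scale)
    also have "\<dots> = (\<Sum>d\<in>D. if d = b then c d else 0)"
      using B by (intro sum.cong) (auto simp: D_def representation_basis representation_scale span_base)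
    finally show ?thesis using r0[OF c b] b fD by simp
  qed
  ultimately have "quotient_basis scale (topspace T) W D"
    using DT fD by (auto simp: quotient_basis_iff[OF subspace_topspace W(1)])
  with that show ?thesis by blast
qed

lemma linearly_compact_subspace_quotient_basis:
  assumes U: "linearly_compact_subspace scale T U" and W: "subspace W" "openin T W"
  obtains B where "quotient_basis scale U (W \<inter> U) B"
proof -
  have U': "linear_subspace scale T U" "subspace U" "U \<subseteq> topspace T"
    using U by (auto simp: linearly_compact_subspace_def linear_subspace_def)
  interpret U: top_vec_space scale "subtopology T U"
    using U'(1) by (rule top_vec_space_subtopology)
  obtain B where "quotient_basis scale (topspace (subtopology T U)) (W \<inter> U) B"
    using U.linearly_compact_quotient_basis[of "W \<inter> U"] U W U'
    by (auto simp: linearly_compact_subspace_def openin_subtopology subspace_inter)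
  with U' that show ?thesis by (simp add: Int_absorb1)
qed

text \<open>As \<open>C\<close> is closed, a closed variety of \<open>C\<close> is also a closed
  variety of \<open>A\<close>, so families in \<open>C\<close> inherit the intersection property
  from \<open>A\<close>.\<close>

lemma linearly_compact_subspace_closed_subset:
  assumes A: "linearly_compact_subspace scale T A" and C: "subspace C" "C \<subseteq> A" "closedin T C"
  shows "linearly_compact_subspace scale T C"
proof -
  have A': "linear_subspace scale T A" "subspace A" "A \<subseteq> topspace T"
    and Alc: "linearly_compact scale (subtopology T A)"
    using A by (auto simp: linearly_compact_subspace_def linear_subspace_def)
  interpret A: top_vec_space scale "subtopology T A"
    using A'(1) by (rule top_vec_space_subtopology)
  have CA: "linear_subspace scale (subtopology T A) C" "linear_subspace scale T C"
    using C A' by (auto simp: linear_subspace_def)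
  have eq: "subtopology (subtopology T A) C = subtopology T C"
    using C by (simp add: subtopology_subtopology Int_absorb1)
  have cl: "closed_linear_variety scale (subtopology T A) F"
    if F: "closed_linear_variety scale (subtopology T C) F" for F
  proof -
    obtain v W where "v \<in> C" "linear_subspace scale (subtopology T C) W"
      "closedin (subtopology T C) W" "F = v +o W"
      using F by (auto simp: closed_linear_variety_def)
    moreover from this have "closedin (subtopology T A) W"
      using C
      by (metis eq closedin_subset_topspace closedin_trans_full)
    ultimately show ?thesis
      unfolding closed_linear_variety_def linear_subspace_def
      using C A' by (intro bexI[of _ v] exI[of _ W]) (auto simp: linear_subspace_def)
  qed
  have "linearly_topologized scale (subtopology T C)"
    using A.linearly_topologized_subtopology[OF _ CA(1)] Alc
    by (simp add: eq linearly_compact_def)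
  with Alc cl CA(2) show ?thesis
    unfolding linearly_compact_subspace_def linearly_compact_def by (metis (no_types, lifting))
qed

end

section \<open>The Lefschetz dual\<close>

lemma fun_sum_apply: "(\<Sum>i\<in>I. f i) x = (\<Sum>i\<in>I. (f i x :: 'k::comm_monoid_add))"
  by (induction I rule: infinite_finite_induct) auto

locale loc_lin_compact = top_vec_space +
  assumes llc: "locally_linearly_compact scale T"
begin

abbreviation (input) "lco \<equiv> lc_open_subspaces scale T"
abbreviation (input) "perp \<equiv> annihilator scale T"
abbreviation (input) "V' \<equiv> CHom scale T"
abbreviation (input) "T' \<equiv> dual_topology scale T"

section \<open>The system of linearly compact open subspaces\<close>

lemma lcoD:
  assumes "U \<in> lco"
  shows "linearly_compact_subspace scale T U" "subspace U" "U \<subseteq> topspace T" "openin T U" "0 \<in> U"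
  using assms subspace_0[of U]
  by (simp_all add: lc_open_subspaces_def linearly_compact_subspace_def linear_subspace_def)

lemma lco_basis:
  assumes "openin T G" "0 \<in> G"
  obtains U where "U \<in> lco" "U \<subseteq> G"
proof -
  obtain \<N> where "nhd_basis_at T 0 \<N>" "\<N> \<subseteq> lco"
    using llc by (auto simp: locally_linearly_compact_def)
  moreover from this obtain N where "N \<in> \<N>" "N \<subseteq> G"
    using assms unfolding nhd_basis_at_def by blast
  ultimately show ?thesis using that by blast
qed

lemma lco_exists: obtains U where "U \<in> lco"
  using lco_basis[of "topspace T"] subspace_0[OF subspace_topspace] by auto

lemma lco_subset:
  assumes "U \<in> lco" "subspace C" "openin T C" "C \<subseteq> U"
  shows "C \<in> lco"
  using linearly_compact_subspace_closed_subset[OF lcoD(1)[OF assms(1)] assms(2,4)]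
    open_subspace_closed[OF assms(2,3)] assms(3)
  by (simp add: lc_open_subspaces_def)

lemma lco_Int: "A \<in> lco \<Longrightarrow> B \<in> lco \<Longrightarrow> A \<inter> B \<in> lco"
  by (rule lco_subset[of A]) (auto intro: subspace_inter lcoD)

text \<open>Hausdorff separation comes from the basic subspaces: a nonzero \<open>z\<close> in
  \<open>U\<close> is separated from 0 within \<open>U\<close>, and sets open in \<open>U\<close>
  are open in \<open>T\<close>; a \<open>z\<close> outside \<open>U\<close> is already excluded by
  \<open>U\<close>. Cosets then separate arbitrary points.\<close>

lemma linearly_topologized: "linearly_topologized scale T"
proof -
  obtain \<N> where N: "nhd_basis_at T 0 \<N>" "\<N> \<subseteq> lco"
    using llc by (auto simp: locally_linearly_compact_def)
  have "\<exists>U\<in>lco. z \<notin> U" if z: "z \<in> topspace T" "z \<noteq> 0" for z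
  proof -
    obtain U where U: "U \<in> lco" by (rule lco_exists)
    note U' = lcoD[OF U]
    show ?thesis
    proof (cases "z \<in> U")
      case True
      have "Hausdorff_space (subtopology T U)"
        using U'(1) by (simp add: linearly_compact_subspace_def linearly_compact_def linearly_topologized_def)
      moreover have "0 \<in> topspace (subtopology T U)" "z \<in> topspace (subtopology T U)" "0 \<noteq> z"
        using True U' z by auto
      ultimately obtain G H where "openin (subtopology T U) G" "0 \<in> G" "z \<in> H" "disjnt G H"
        unfolding Hausdorff_space_def by blast
      then have "openin T G" "0 \<in> G" "z \<notin> G"
        using U' by (auto simp: openin_open_subtopology disjnt_iff)
      then show ?thesis by (meson lco_basis subsetD)
    qed (use U in blast)
  qed
  then have sep: "\<exists>U\<in>lco. x - y \<notin> U" if "x \<in> topspace T" "y \<in> topspace T" "x \<noteq> y" for x y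
    using that subspace_diff[OF subspace_topspace] by simp
  have "Hausdorff_space T"
    unfolding Hausdorff_space_def
  proof (intro allI impI, elim conjE)
    fix x y assume xy: "x \<in> topspace T" "y \<in> topspace T" "x \<noteq> y"
    then obtain U where U: "U \<in> lco" "x - y \<notin> U" using sep by blast
    note U' = lcoD[OF U(1)]
    have "disjnt (x +o U) (y +o U)"
      unfolding disjnt_iff
    proof (intro allI notI)
      fix z assume "z \<in> x +o U \<and> z \<in> y +o U"
      then have "z - y \<in> U" "z - x \<in> U" by (auto simp: set_minus_plus)
      from subspace_diff[OF U'(2) this] U(2) show False by simp
    qed
    moreover have "x \<in> x +o U" "y \<in> y +o U" using U' by (auto simp: elt_set_plus_def)
    ultimately show "\<exists>A B. openin T A \<and> openin T B \<and> x \<in> A \<and> y \<in> B \<and> disjnt A B"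
      using openin_coset[OF U'(4)] xy by blast
  qed
  moreover have "\<forall>N\<in>\<N>. linear_subspace scale T N"
    using N(2) lcoD(2,3) unfolding linear_subspace_def by blast
  ultimately show ?thesis
    using tvs N(1) unfolding linearly_topologized_def by blast
qed

lemma lco_finite_extension:
  assumes "U \<in> lco" "finite F" "F \<subseteq> topspace T"
  shows "span (U \<union> F) \<in> lco"
proof -
  note U = lcoD[OF assms(1)]
  have "openin T (span (U \<union> F))"
  proof (rule openin_superspace[OF _ _ U(4,5)])
    show "span (U \<union> F) \<subseteq> topspace T"
      using U assms subspace_topspace by (intro span_minimal) auto
    show "U \<subseteq> span (U \<union> F)" using span_superset by blast
  qed simp
  with linearly_compact_subspace_span_Un[OF linearly_topologized U(1) assms(2,3)] show ?thesis
    by (simp add: lc_open_subspaces_def)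
qed

text \<open>\<open>U \<inter> A\<close> is open in the linearly compact \<open>A\<close>, so
  finitely many vectors span \<open>A\<close> over it; adding them to \<open>U\<close> gives
  \<open>A'\<close>. Hence linearly compact open subspaces are cofinal among all linearly compact
  ones, and their annihilators suffice to describe the dual topology.\<close>

lemma lco_upper:
  assumes A: "linearly_compact_subspace scale T A" and U: "U \<in> lco"
  obtains A' where "A' \<in> lco" "A \<subseteq> A'" "U \<subseteq> A'"
proof -
  have A': "subspace A" "A \<subseteq> topspace T"
    using A by (auto simp: linearly_compact_subspace_def linear_subspace_def)
  have UA: "subspace (U \<inter> A)" by (rule subspace_inter[OF lcoD(2)[OF U] A'(1)])
  obtain B where B: "quotient_basis scale A (U \<inter> A) B"
    using linearly_compact_subspace_quotient_basis[OF A lcoD(2,4)[OF U]] by blast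
  then have B': "finite B" "B \<subseteq> A" by (auto simp: quotient_basis_def)
  have "A = span ((U \<inter> A) \<union> B)"
    by (rule quotient_basis_span[OF A'(1) UA _ B]) simp
  also have "\<dots> \<subseteq> span (U \<union> B)" by (rule span_mono) blast
  finally show ?thesis
    using that[of "span (U \<union> B)"] lco_finite_extension[OF U B'(1)] B' A' span_superset[of "U \<union> B"] by blast
qed

section \<open>Continuous functionals and annihilators\<close>

lemma CHom_iff:
  "\<xi> \<in> V' \<longleftrightarrow> linear_map_on (topspace T) scale (*) \<xi> \<and> (\<forall>x. x \<notin> topspace T \<longrightarrow> \<xi> x = 0) \<and>
     (\<exists>U\<in>lco. \<forall>u\<in>U. \<xi> u = 0)" (is "?L \<longleftrightarrow> ?R")
proof
  assume L: ?L
  \<comment> \<open>The field is discrete, so the kernel is open and contains a basic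
    subspace.\<close>
  then have "openin T {x \<in> topspace T. \<xi> x \<in> {0}}"
    by (intro openin_continuous_map_preimage[where Y = "discrete_topology UNIV"]) (auto simp: CHom_def)
  moreover have "\<xi> 0 = 0"
    using L subspace_topspace by (auto simp: CHom_def intro: linear_map_on_0)
  ultimately obtain U where "U \<in> lco" "U \<subseteq> {x \<in> topspace T. \<xi> x \<in> {0}}"
    using subspace_0[OF subspace_topspace] by (elim lco_basis) auto
  with L show ?R by (auto simp: CHom_def)
next
  assume R: ?R
  then obtain U where U: "U \<in> lco" "\<And>u. u \<in> U \<Longrightarrow> \<xi> u = 0" by blast
  note U' = lcoD[OF U(1)]
  have lin: "linear_map_on (topspace T) scale (*) \<xi>" using R by blast
  \<comment> \<open>\<open>\<xi>\<close> is constant on the cosets of \<open>U\<close>, so every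
    preimage is a union of such cosets.\<close>
  have "openin T {x \<in> topspace T. \<xi> x \<in> S}" for S
  proof (subst openin_subopen, intro ballI)
    fix x assume x: "x \<in> {x \<in> topspace T. \<xi> x \<in> S}"
    have "x +o U \<subseteq> {x \<in> topspace T. \<xi> x \<in> S}"
    proof
      fix y assume "y \<in> x +o U"
      then obtain u where "u \<in> U" "y = x + u" by (auto simp: elt_set_plus_def)
      with x U' U(2) show "y \<in> {x \<in> topspace T. \<xi> x \<in> S}"
        using linear_map_onD(1)[OF lin, of x u] subspace_add[OF subspace_topspace, of x u] by auto
    qed
    moreover have "x \<in> x +o U" using U'(5) by (auto simp: elt_set_plus_def)
    ultimately show "\<exists>G. openin T G \<and> x \<in> G \<and> G \<subseteq> {x \<in> topspace T. \<xi> x \<in> S}"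
      using openin_coset[OF U'(4), of x] x by blast
  qed
  with R show ?L by (auto simp: CHom_def continuous_map_def)
qed

lemma CHom_linear: "\<xi> \<in> V' \<Longrightarrow> linear_map_on (topspace T) scale (*) \<xi>"
  by (simp add: CHom_iff)

lemma perpD:
  assumes "\<xi> \<in> perp A"
  shows "\<xi> \<in> V'" "a \<in> A \<Longrightarrow> \<xi> a = 0"
  using assms by (auto simp: annihilator_def)

lemma perp_antimono: "A \<subseteq> B \<Longrightarrow> perp B \<subseteq> perp A"
  by (auto simp: annihilator_def)

lemma subspace_CHom: "functional.subspace V'"
  unfolding functional.subspace_def
proof (intro conjI ballI allI)
  obtain U where U: "U \<in> lco" by (rule lco_exists)
  then show "0 \<in> V'" by (auto simp: CHom_iff linear_map_on_def)
next
  fix \<xi> \<eta> assume \<xi>: "\<xi> \<in> V'" and \<eta>: "\<eta> \<in> V'"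
  from \<xi> obtain A where A: "A \<in> lco" "\<And>a. a \<in> A \<Longrightarrow> \<xi> a = 0" by (auto simp: CHom_iff)
  from \<eta> obtain B where B: "B \<in> lco" "\<And>b. b \<in> B \<Longrightarrow> \<eta> b = 0" by (auto simp: CHom_iff)
  have "\<exists>U\<in>lco. \<forall>u\<in>U. (\<xi> + \<eta>) u = 0"
    using A B by (intro bexI[of _ "A \<inter> B"] lco_Int) auto
  with \<xi> \<eta> show "\<xi> + \<eta> \<in> V'"
    by (auto simp: CHom_iff linear_map_on_def algebra_simps)
next
  fix c \<xi> assume "\<xi> \<in> V'"
  then show "fun_smul c \<xi> \<in> V'"
    by (auto simp: CHom_iff linear_map_on_def algebra_simps fun_smul_def)
qed

lemma subspace_perp: "functional.subspace (perp A)"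
  using subspace_CHom by (auto simp: functional.subspace_def annihilator_def fun_smul_def)

lemma perp_topspace: "perp (topspace T) = {0}"
proof
  show "perp (topspace T) \<subseteq> {0}"
  proof
    fix \<xi> assume "\<xi> \<in> perp (topspace T)"
    then have "\<xi> x = 0" for x by (cases "x \<in> topspace T") (auto simp: annihilator_def CHom_iff)
    then show "\<xi> \<in> {0}" by auto
  qed
  show "{0} \<subseteq> perp (topspace T)" using functional.subspace_0[OF subspace_perp] by auto
qed

text \<open>This takes the place of a Hahn-Banach theorem: an extension that vanishes on the open
  \<open>U\<close> is continuous by \<open>CHom_iff\<close>, so only algebra is left. Gluing,
  splitting, factoring through \<open>f\<close> and dual bases are instances with different
  \<open>P\<close>.\<close>

lemma perp_extend:
  assumes "openin T U" "0 \<in> U"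
    and "\<And>x y c d. P x c \<Longrightarrow> P y d \<Longrightarrow> P (x + y) (c + d)"
    and "\<And>a x c. P x c \<Longrightarrow> P (scale a x) (a * c)"
    and "\<And>c. P 0 c \<Longrightarrow> c = 0" and PU: "\<And>u. u \<in> U \<Longrightarrow> P u 0"
  obtains \<xi> where "\<xi> \<in> perp U" "\<And>x c. P x c \<Longrightarrow> x \<in> topspace T \<Longrightarrow> \<xi> x = c"
proof -
  obtain g where g: "linear_map_on UNIV scale (*) g" "\<And>x c. P x c \<Longrightarrow> g x = c"
    using linear_relation_extend[of P] assms by metis
  \<comment> \<open>The value 0 outside the carrier is the normal form that \<open>CHom\<close>
    demands.\<close>
  define \<xi> where "\<xi> x = (if x \<in> topspace T then g x else 0)" for x
  obtain A where A: "A \<in> lco" "A \<subseteq> U" using lco_basis assms(1,2) by blast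
  have 0: "\<xi> u = 0" if "u \<in> U" for u
    using g(2)[OF PU[OF that]] by (simp add: \<xi>_def)
  have "linear_map_on (topspace T) scale (*) \<xi>"
    using g(1) subspace_topspace
    by (auto simp: linear_map_on_def \<xi>_def subspace_add subspace_scale)
  moreover have "\<forall>x. x \<notin> topspace T \<longrightarrow> \<xi> x = 0" by (simp add: \<xi>_def)
  ultimately have "\<xi> \<in> V'" unfolding CHom_iff using A 0 by blast
  then have "\<xi> \<in> perp U" using 0 by (auto simp: annihilator_def)
  then show ?thesis using that[of \<xi>] g(2) by (simp add: \<xi>_def)
qed

section \<open>The dual topology\<close>

lemma CHom_coset: "\<xi> \<in> V' \<Longrightarrow> \<xi> +o perp A \<subseteq> V'"
  using functional.subspace_add[OF subspace_CHom] perpD(1) by (auto simp: elt_set_plus_def)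

lemma self_coset: "\<xi> \<in> \<xi> +o perp A"
  using functional.subspace_0[OF subspace_perp] by (auto simp: elt_set_plus_def)

lemma openin_dual_coset:
  assumes "A \<in> lco" "\<xi> \<in> V'"
  shows "openin T' (\<xi> +o perp A)"
  unfolding dual_topology_def using assms lcoD(1)
  by (intro topology_generated_by_Basis) blast

text \<open>Two linearly compact open subspaces have a common upper bound by
  \<open>lco_upper\<close>, and \<open>perp\<close> reverses inclusion, so the local condition
  survives finite intersections. The same lemma replaces the arbitrary linearly compact
  \<open>A\<close> of \<open>dual_topology\<close> by an open one.\<close>

lemma openin_dual_iff:
  "openin T' G \<longleftrightarrow> G \<subseteq> V' \<and> (\<forall>\<xi>\<in>G. \<exists>A\<in>lco. \<xi> +o perp A \<subseteq> G)" (is "?L \<longleftrightarrow> ?R")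
proof
  let ?S = "{\<xi> +o perp A | \<xi> A. \<xi> \<in> V' \<and> linearly_compact_subspace scale T A}"
  assume ?L
  then have "generate_topology_on ?S G"
    unfolding dual_topology_def by (rule openin_topology_generated_by)
  then show ?R
  proof induction
    case (Int G H)
    have "\<exists>A\<in>lco. \<xi> +o perp A \<subseteq> G \<inter> H" if \<xi>: "\<xi> \<in> G" "\<xi> \<in> H" for \<xi>
    proof -
      obtain A B where A: "A \<in> lco" "\<xi> +o perp A \<subseteq> G" and B: "B \<in> lco" "\<xi> +o perp B \<subseteq> H"
        using bspec[OF conjunct2[OF Int.IH(1)] \<xi>(1)] bspec[OF conjunct2[OF Int.IH(2)] \<xi>(2)] by blast
      obtain C where C: "C \<in> lco" "A \<subseteq> C" "B \<subseteq> C" by (rule lco_upper[OF lcoD(1)[OF A(1)] B(1)])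
      have "\<xi> +o perp C \<subseteq> \<xi> +o perp A" "\<xi> +o perp C \<subseteq> \<xi> +o perp B"
        using C(2,3) by (auto intro!: set_plus_mono perp_antimono)
      with A B C(1) show ?thesis by blast
    qed
    moreover have "G \<inter> H \<subseteq> V'" using Int.IH(1) by blast
    ultimately show ?case by blast
  next
    case (UN K)
    show ?case
    proof (intro conjI ballI)
      show "\<Union>K \<subseteq> V'" using UN.IH by (intro Union_least) blast
    next
      fix \<xi> assume "\<xi> \<in> \<Union>K"
      then obtain k where k: "k \<in> K" "\<xi> \<in> k" by blast
      obtain A where "A \<in> lco" "\<xi> +o perp A \<subseteq> k"
        using bspec[OF conjunct2[OF UN.IH[OF k(1)]] k(2)] by blast
      with k(1) show "\<exists>A\<in>lco. \<xi> +o perp A \<subseteq> \<Union>K" by blast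
    qed
  next
    case (Basis G)
    then obtain \<eta> A where G: "G = \<eta> +o perp A" "\<eta> \<in> V'" "linearly_compact_subspace scale T A" by blast
    obtain U where U: "U \<in> lco" by (rule lco_exists)
    obtain A' where A': "A' \<in> lco" "A \<subseteq> A'" by (rule lco_upper[OF G(3) U])
    \<comment> \<open>Every point of a coset of \<open>perp A\<close> can serve as its base point,
      and \<open>perp A'\<close> is contained in \<open>perp A\<close>.\<close>
    have "\<xi> +o perp A' \<subseteq> G" if "\<xi> \<in> G" for \<xi>
    proof
      fix \<psi> assume "\<psi> \<in> \<xi> +o perp A'"
      then have "\<psi> - \<xi> \<in> perp A"
        using perp_antimono[OF A'(2)] set_plus_imp_minus[of \<psi> \<xi> "perp A'"] by blast
      moreover have "\<xi> - \<eta> \<in> perp A"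
        using that unfolding G(1) by (rule set_plus_imp_minus)
      moreover note functional.subspace_add[OF subspace_perp, of "\<psi> - \<xi>" A "\<xi> - \<eta>"]
      ultimately show "\<psi> \<in> G"
        unfolding G(1) set_minus_plus[symmetric] by simp
    qed
    moreover have "G \<subseteq> V'" unfolding G(1) by (rule CHom_coset[OF G(2)])
    ultimately show ?case using A'(1) by blast
  qed simp
next
  assume R: ?R
  show ?L
  proof (subst openin_subopen, intro ballI)
    fix \<xi> assume \<xi>: "\<xi> \<in> G"
    obtain A where A: "A \<in> lco" "\<xi> +o perp A \<subseteq> G"
      using bspec[OF conjunct2[OF R] \<xi>] by blast
    have "\<xi> \<in> V'" using \<xi> R by blast
    with A show "\<exists>H. openin T' H \<and> \<xi> \<in> H \<and> H \<subseteq> G"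
      using openin_dual_coset[OF A(1)] self_coset[of \<xi> A] by blast
  qed
qed

lemma topspace_dual: "topspace T' = V'"
proof
  show "topspace T' \<subseteq> V'" using openin_dual_iff[of "topspace T'"] by simp
  obtain U where "U \<in> lco" by (rule lco_exists)
  then have "openin T' V'" using CHom_coset by (auto simp: openin_dual_iff)
  then show "V' \<subseteq> topspace T'" by (rule openin_subset)
qed

lemma openin_perp: "A \<in> lco \<Longrightarrow> openin T' (perp A)"
  using openin_dual_coset[of A 0] functional.subspace_0[OF subspace_CHom] by simp

lemma top_vec_space_dual: "top_vec_space fun_smul T'"
proof unfold_locales
  have "continuous_map (prod_topology T' T') T' (\<lambda>(x, y). x + y)"
    unfolding continuous_map_def
  proof (intro conjI allI impI)
    show "(\<lambda>(x, y). x + y) \<in> topspace (prod_topology T' T') \<rightarrow> topspace T'"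
      by (auto simp: topspace_dual intro: functional.subspace_add[OF subspace_CHom])
    fix G assume G: "openin T' G"
    show "openin (prod_topology T' T') {x \<in> topspace (prod_topology T' T'). (case x of (x, y) \<Rightarrow> x + y) \<in> G}"
      unfolding openin_prod_topology_alt
    proof (intro allI impI)
      fix \<xi> \<eta> assume "(\<xi>, \<eta>) \<in> {x \<in> topspace (prod_topology T' T'). (case x of (x, y) \<Rightarrow> x + y) \<in> G}"
      then have \<xi>\<eta>: "\<xi> \<in> V'" "\<eta> \<in> V'" "\<xi> + \<eta> \<in> G" by (auto simp: topspace_dual)
      then obtain A where A: "A \<in> lco" "(\<xi> + \<eta>) +o perp A \<subseteq> G" using G by (auto simp: openin_dual_iff)
      have sum: "\<xi>' + \<eta>' \<in> G" if "\<xi>' \<in> \<xi> +o perp A" "\<eta>' \<in> \<eta> +o perp A" for \<xi>' \<eta>'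
      proof -
        have "(\<xi>' - \<xi>) + (\<eta>' - \<eta>) \<in> perp A"
          by (intro functional.subspace_add[OF subspace_perp] set_plus_imp_minus that)
        then have "\<xi>' + \<eta>' \<in> (\<xi> + \<eta>) +o perp A"
          unfolding set_minus_plus[symmetric] by (simp add: algebra_simps)
        with A(2) show ?thesis by blast
      qed
      show "\<exists>U V. openin T' U \<and> openin T' V \<and> \<xi> \<in> U \<and> \<eta> \<in> V \<and>
          U \<times> V \<subseteq> {x \<in> topspace (prod_topology T' T'). (case x of (x, y) \<Rightarrow> x + y) \<in> G}"
        by (rule exI[of _ "\<xi> +o perp A"], rule exI[of _ "\<eta> +o perp A"])
          (use openin_dual_coset[OF A(1) \<xi>\<eta>(1)] openin_dual_coset[OF A(1) \<xi>\<eta>(2)] self_coset[of _ A]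
            CHom_coset[OF \<xi>\<eta>(1)] CHom_coset[OF \<xi>\<eta>(2)] sum in \<open>force simp: topspace_dual\<close>)
    qed
  qed
  moreover have "continuous_map (prod_topology (discrete_topology UNIV) T') T' (\<lambda>(c, x). fun_smul c x)"
    (is "continuous_map ?X _ ?f")
    unfolding continuous_map_def
  proof (intro conjI allI impI)
    show "?f \<in> topspace ?X \<rightarrow> topspace T'"
      by (auto simp: topspace_dual intro: functional.subspace_scale[OF subspace_CHom])
    fix G assume G: "openin T' G"
    show "openin ?X {x \<in> topspace ?X. ?f x \<in> G}"
      unfolding openin_prod_topology_alt
    proof (intro allI impI)
      fix c \<xi> assume "(c, \<xi>) \<in> {x \<in> topspace ?X. ?f x \<in> G}"
      then have \<xi>: "\<xi> \<in> V'" "fun_smul c \<xi> \<in> G" by (auto simp: topspace_dual)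
      then obtain A where A: "A \<in> lco" "fun_smul c \<xi> +o perp A \<subseteq> G" using G by (auto simp: openin_dual_iff)
      have mul: "fun_smul c \<xi>' \<in> G" if "\<xi>' \<in> \<xi> +o perp A" for \<xi>'
      proof -
        have "fun_smul c (\<xi>' - \<xi>) \<in> perp A"
          by (intro functional.subspace_scale[OF subspace_perp] set_plus_imp_minus that)
        then have "fun_smul c \<xi>' \<in> fun_smul c \<xi> +o perp A"
          unfolding set_minus_plus[symmetric] by (simp add: functional.scale_right_diff_distrib)
        with A(2) show ?thesis by blast
      qed
      \<comment> \<open>The scalars are discrete, so \<open>{c}\<close> is an open neighbourhood of
        \<open>c\<close>.\<close>
      show "\<exists>U V. openin (discrete_topology UNIV) U \<and> openin T' V \<and> c \<in> U \<and> \<xi> \<in> V \<and>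
          U \<times> V \<subseteq> {x \<in> topspace ?X. ?f x \<in> G}"
        by (rule exI[of _ "{c}"], rule exI[of _ "\<xi> +o perp A"])
          (use openin_dual_coset[OF A(1) \<xi>(1)] self_coset[of _ A] CHom_coset[OF \<xi>(1)] mul
            in \<open>force simp: topspace_dual\<close>)
    qed
  qed
  ultimately show "topological_vec_space fun_smul T'"
    by (simp add: topological_vec_space_def topspace_dual subspace_CHom vector_space_fun_smul)
qed

lemma linearly_topologized_dual: "linearly_topologized fun_smul T'"
proof -
  interpret dual: top_vec_space fun_smul T' by (rule top_vec_space_dual)
  have "nhd_basis_at T' 0 (perp ` lco)"
    unfolding nhd_basis_at_def
  proof (intro conjI ballI allI impI)
    fix N assume "N \<in> perp ` lco"
    then obtain A where A: "A \<in> lco" "N = perp A" by blast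
    then show "N \<subseteq> topspace T'" using perpD(1) unfolding topspace_dual by blast
    show "\<exists>G. openin T' G \<and> 0 \<in> G \<and> G \<subseteq> N"
      unfolding A(2) using openin_perp[OF A(1)] functional.subspace_0[OF subspace_perp, of A] by blast
  next
    fix G assume "openin T' G \<and> 0 \<in> G"
    then obtain A where "A \<in> lco" "0 +o perp A \<subseteq> G" by (auto simp: openin_dual_iff)
    then show "\<exists>N\<in>perp ` lco. N \<subseteq> G" by auto
  qed
  moreover have "\<forall>N\<in>perp ` lco. linear_subspace fun_smul T' N"
    using subspace_perp perpD(1) unfolding linear_subspace_def topspace_dual by blast
  moreover have "Hausdorff_space T'"
    unfolding Hausdorff_space_def
  proof (intro allI impI, elim conjE)
    fix \<xi> \<eta> assume "\<xi> \<in> topspace T'" "\<eta> \<in> topspace T'" "\<xi> \<noteq> \<eta>"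
    then have \<xi>\<eta>: "\<xi> \<in> V'" "\<eta> \<in> V'" "\<xi> \<noteq> \<eta>" by (auto simp: topspace_dual)
    then obtain x where x: "\<xi> x \<noteq> \<eta> x" by (auto simp: fun_eq_iff)
    with \<xi>\<eta> have xT: "x \<in> topspace T" by (metis CHom_iff)
    obtain U where "U \<in> lco" by (rule lco_exists)
    \<comment> \<open>Cosets of \<open>perp ?A\<close> separate functionals that differ at
      \<open>x\<close> once \<open>?A\<close> contains \<open>x\<close>; adjoining \<open>x\<close>
      to \<open>U\<close> achieves this.\<close>
    then have A: "span (U \<union> {x}) \<in> lco" (is "?A \<in> _") using xT by (intro lco_finite_extension) auto
    have xA: "x \<in> ?A" by (auto intro: span_base)
    have "disjnt (\<xi> +o perp ?A) (\<eta> +o perp ?A)"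
      unfolding disjnt_iff
    proof (intro allI notI)
      fix \<psi> assume "\<psi> \<in> \<xi> +o perp ?A \<and> \<psi> \<in> \<eta> +o perp ?A"
      then have "\<psi> - \<xi> \<in> perp ?A" "\<psi> - \<eta> \<in> perp ?A" by (auto simp: set_minus_plus)
      from this[THEN perpD(2), OF xA] x show False by simp
    qed
    then show "\<exists>G H. openin T' G \<and> openin T' H \<and> \<xi> \<in> G \<and> \<eta> \<in> H \<and> disjnt G H"
      using openin_dual_coset[OF A \<xi>\<eta>(1)] openin_dual_coset[OF A \<xi>\<eta>(2)]
        self_coset[of \<xi> ?A] self_coset[of \<eta> ?A] by blast
  qed
  ultimately show ?thesis
    unfolding linearly_topologized_def using dual.tvs by blast
qed

section \<open>Annihilators as the linearly compact open subspaces of the dual\<close>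

lemma linear_subspace_perp: "linear_subspace fun_smul T' (perp A)"
  using subspace_perp perpD(1) unfolding linear_subspace_def topspace_dual by blast

lemma lco_quotient_basis:
  assumes A: "A \<in> lco" and C: "subspace C" "openin T C" "C \<subseteq> A"
  obtains B where "quotient_basis scale A C B" "finite B" "A = span (C \<union> B)"
proof -
  obtain B where "quotient_basis scale A (C \<inter> A) B"
    using linearly_compact_subspace_quotient_basis[OF lcoD(1)[OF A] C(1,2)] by blast
  then have B: "quotient_basis scale A C B" using C(3) by (simp add: Int_absorb2)
  moreover have "finite B" using B by (simp add: quotient_basis_def)
  ultimately show ?thesis using that quotient_basis_span[OF lcoD(2)[OF A] C(1,3) B] by blast
qed

text \<open>A double annihilator theorem with common zeros taken in the original space. If
  \<open>\<xi>\<close> were outside the closed \<open>W\<close>, some coset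
  \<open>\<xi> + perp A\<close> would miss \<open>W\<close>. Enlarged to contain \<open>U\<close>,
  the subspace \<open>A\<close> is spanned by \<open>U\<close> and finitely many vectors, so
  \<open>functional_eq_on_finite_extension\<close> gives a member of \<open>W\<close> that agrees
  with \<open>\<xi>\<close> on it and thus lies in the coset.\<close>

lemma closed_subspace_perp_perp:
  assumes U: "U \<in> lco" and W: "functional.subspace W" "W \<subseteq> perp U" "closedin T' W"
    and \<xi>: "\<xi> \<in> perp U"
    and h: "\<And>x. x \<in> topspace T \<Longrightarrow> (\<And>w. w \<in> W \<Longrightarrow> w x = 0) \<Longrightarrow> \<xi> x = 0"
  shows "\<xi> \<in> W"
proof (rule ccontr)
  assume "\<xi> \<notin> W"
  then have \<xi>W: "\<xi> \<in> V' - W" using perpD(1)[OF \<xi>] by blast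
  have "openin T' (V' - W)" using W(3) by (simp add: closedin_def topspace_dual)
  then obtain A where A: "A \<in> lco" "\<xi> +o perp A \<subseteq> V' - W"
    unfolding openin_dual_iff using \<xi>W by blast
  obtain A' where A': "A' \<in> lco" "A \<subseteq> A'" "U \<subseteq> A'" by (rule lco_upper[OF lcoD(1)[OF A(1)] U])
  obtain B where B: "finite B" "A' = span (U \<union> B)"
    using lco_quotient_basis[OF A'(1) lcoD(2,4)[OF U] A'(3)] by blast
  have A'T: "span (U \<union> B) \<subseteq> topspace T" using lcoD(3)[OF A'(1)] B(2) by simp
  have lin: "linear_map_on (span (U \<union> B)) scale (*) \<eta>" if "\<eta> \<in> perp U" for \<eta>
    using CHom_linear[OF perpD(1)[OF that]] A'T by (rule linear_map_on_subset)
  have "\<exists>w\<in>W. \<forall>x\<in>span (U \<union> B). w x = \<xi> x"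
    by (rule functional_eq_on_finite_extension[OF B(1) W(1)])
      (use lin W(2) \<xi> perpD(2) h A'T in blast)+
  then obtain w where w: "w \<in> W" "\<And>x. x \<in> A' \<Longrightarrow> w x = \<xi> x" using B(2) by blast
  have "w - \<xi> \<in> V'"
    using functional.subspace_diff[OF subspace_perp, of w U \<xi>] w(1) W(2) \<xi> perpD(1) by blast
  then have "w - \<xi> \<in> perp A" using w(2) A'(2) by (auto simp: annihilator_def)
  then have "w \<in> \<xi> +o perp A" by (rule set_minus_imp_plus)
  with A(2) w(1) show False by blast
qed

text \<open>A functional in the intersection is glued from restrictions: a closed variety \<open>F\<close> in
  \<open>perp U\<close> prescribes the values on the subspace \<open>S F\<close>, and the finite intersection property makes
  the prescriptions compatible.\<close>

lemma perp_linearly_compact: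
  assumes U: "U \<in> lco"
  shows "linearly_compact_subspace fun_smul T' (perp U)"
proof -
  interpret dual: top_vec_space fun_smul T' by (rule top_vec_space_dual)
  note U' = lcoD[OF U]
  let ?X = "subtopology T' (perp U)"
  have tX: "topspace ?X = perp U" using perpD(1) by (auto simp: topspace_dual)
  have cl: "closedin T' (perp U)"
    by (rule dual.open_subspace_closed[OF subspace_perp openin_perp[OF U]])
  \<comment> \<open>For \<open>F = \<xi> + W\<close> these are the common zeros of \<open>W\<close>
    in the carrier.\<close>
  define S where "S F = {x \<in> topspace T. \<forall>f\<in>F. \<forall>g\<in>F. f x = g x}" for F :: "('b \<Rightarrow> 'a) set"
  have "\<Inter>\<F> \<noteq> {}" if \<F>: "\<forall>F\<in>\<F>. closed_linear_variety fun_smul ?X F"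
    and fip: "\<forall>\<G>. \<G> \<subseteq> \<F> \<and> finite \<G> \<longrightarrow> \<Inter>\<G> \<noteq> {}" for \<F>
  proof -
    have variety: "\<exists>\<xi> W. \<xi> \<in> perp U \<and> functional.subspace W \<and> W \<subseteq> perp U \<and> closedin T' W \<and> F = \<xi> +o W"
      if "F \<in> \<F>" for F
      using bspec[OF \<F> that] closedin_trans_full[OF _ cl] unfolding closed_linear_variety_def
        linear_subspace_def tX by blast
    have Fsub: "F \<subseteq> perp U" if F: "F \<in> \<F>" for F
    proof -
      obtain \<xi> W where "\<xi> \<in> perp U" "W \<subseteq> perp U" "F = \<xi> +o W" using variety[OF F] by blast
      then show ?thesis
        using functional.subspace_add[OF subspace_perp] by (auto simp: elt_set_plus_def)
    qed
    \<comment> \<open>The intersection of an empty \<open>\<G>\<close> is \<open>UNIV\<close>, so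
      membership in \<open>perp U\<close> has to be asked for separately.\<close>
    have fip': "\<exists>\<eta>\<in>perp U. \<eta> \<in> \<Inter>\<G>" if G: "finite \<G>" "\<G> \<subseteq> \<F>" for \<G>
    proof (cases "\<G> = {}")
      case True
      then show ?thesis using functional.subspace_0[OF subspace_perp] by blast
    next
      case False
      obtain \<eta> where "\<eta> \<in> \<Inter>\<G>" using fip G by blast
      with False Fsub G(2) show ?thesis by blast
    qed
    \<comment> \<open>The subspace on which values are forced: 0 on \<open>U\<close>, and on each
      \<open>S F\<close> whatever \<open>F\<close> prescribes.\<close>
    define D where "D \<G> = span (U \<union> \<Union>(S ` \<G>))" for \<G>
    have DT: "D \<G> \<subseteq> topspace T" for \<G>
      unfolding D_def using U' by (intro span_minimal subspace_topspace) (auto simp: S_def)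
    have agree: "\<eta> x = \<eta>' x"
      if "\<eta> \<in> perp U" "\<eta>' \<in> perp U" "\<eta> \<in> \<Inter>\<G>" "\<eta>' \<in> \<Inter>\<G>" "x \<in> D \<G>" for \<eta> \<eta>' \<G> x
    proof (rule linear_map_on_eq_span[where S = "U \<union> \<Union>(S ` \<G>)"])
      show "x \<in> span (U \<union> \<Union>(S ` \<G>))" using that(5) by (simp add: D_def)
      show "U \<union> \<Union>(S ` \<G>) \<subseteq> topspace T" using U' by (auto simp: S_def)
      fix y assume "y \<in> U \<union> \<Union>(S ` \<G>)"
      then show "\<eta> y = \<eta>' y"
      proof
        assume "y \<in> U"
        then show ?thesis using that(1,2)[THEN perpD(2)] by simp
      next
        assume "y \<in> \<Union>(S ` \<G>)"
        then obtain F where "F \<in> \<G>" "y \<in> S F" by blast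
        then show ?thesis using that(3,4) by (auto simp: S_def)
      qed
    qed (use that(1,2)[THEN perpD(1)] CHom_linear subspace_topspace in auto)
    \<comment> \<open>Values are read off from a common member of a finite subfamily. By
      \<open>agree\<close> the choice of the member does not matter, and the union of two
      subfamilies compares their values.\<close>
    define P where "P x c \<longleftrightarrow> (\<exists>\<G> \<eta>. finite \<G> \<and> \<G> \<subseteq> \<F> \<and> \<eta> \<in> perp U \<and> \<eta> \<in> \<Inter>\<G> \<and> x \<in> D \<G> \<and> c = \<eta> x)"
      for x c
    obtain \<psi> where \<psi>: "\<psi> \<in> perp U" "\<And>x c. P x c \<Longrightarrow> x \<in> topspace T \<Longrightarrow> \<psi> x = c"
    proof (rule perp_extend[OF U'(4,5), of P])
      fix x y c d assume "P x c" "P y d"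
      then obtain \<G> \<eta> \<H> \<theta> where G: "finite \<G>" "\<G> \<subseteq> \<F>" "\<eta> \<in> perp U" "\<eta> \<in> \<Inter>\<G>" "x \<in> D \<G>" "c = \<eta> x"
        and H: "finite \<H>" "\<H> \<subseteq> \<F>" "\<theta> \<in> perp U" "\<theta> \<in> \<Inter>\<H>" "y \<in> D \<H>" "d = \<theta> y"
        unfolding P_def by metis
      obtain \<zeta> where \<zeta>: "\<zeta> \<in> perp U" "\<zeta> \<in> \<Inter>(\<G> \<union> \<H>)"
        using fip'[of "\<G> \<union> \<H>"] G(1,2) H(1,2) by auto
      have "D \<G> \<subseteq> D (\<G> \<union> \<H>)" "D \<H> \<subseteq> D (\<G> \<union> \<H>)"
        unfolding D_def by (intro span_mono; blast)+
      then have xy: "x \<in> D (\<G> \<union> \<H>)" "y \<in> D (\<G> \<union> \<H>)" using G H by auto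
      have "c = \<zeta> x" "d = \<zeta> y"
        using agree[OF G(3) \<zeta>(1) G(4) _ G(5)] agree[OF H(3) \<zeta>(1) H(4) _ H(5)] \<zeta>(2) G(6) H(6) by auto
      moreover have "\<zeta> (x + y) = \<zeta> x + \<zeta> y"
        using xy DT by (intro linear_map_onD(1)[OF CHom_linear[OF perpD(1)[OF \<zeta>(1)]]]) auto
      moreover have "x + y \<in> D (\<G> \<union> \<H>)" using xy unfolding D_def by (rule span_add)
      ultimately show "P (x + y) (c + d)"
        unfolding P_def using G(1,2) H(1,2) \<zeta> by (intro exI[of _ "\<G> \<union> \<H>"] exI[of _ \<zeta>]) auto
    next
      fix a x c assume "P x c"
      then obtain \<G> \<eta> where G: "finite \<G>" "\<G> \<subseteq> \<F>" "\<eta> \<in> perp U" "\<eta> \<in> \<Inter>\<G>" "x \<in> D \<G>" "c = \<eta> x"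
        unfolding P_def by metis
      have "\<eta> (scale a x) = a * \<eta> x"
        using G(5) DT by (intro linear_map_onD(2)[OF CHom_linear[OF perpD(1)[OF G(3)]]]) auto
      moreover have "scale a x \<in> D \<G>" using G(5) unfolding D_def by (rule span_scale)
      ultimately show "P (scale a x) (a * c)" unfolding P_def using G by metis
    next
      fix c assume "P 0 c"
      then obtain \<eta> where "\<eta> \<in> perp U" "c = \<eta> 0" unfolding P_def by metis
      then show "c = 0" using U'(5) perpD(2) by blast
    next
      fix u assume u: "u \<in> U"
      then have "u \<in> D {}" by (auto simp: D_def intro: span_base)
      then show "P u 0"
        unfolding P_def using functional.subspace_0[OF subspace_perp, of U]
        by (intro exI[of _ "{}"] exI[of _ 0]) auto
    next
      fix \<psi> assume "\<psi> \<in> perp U" "\<And>x c. P x c \<Longrightarrow> x \<in> topspace T \<Longrightarrow> \<psi> x = c"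
      then show thesis by (rule that)
    qed
    have "\<psi> \<in> F" if F: "F \<in> \<F>" for F
    proof -
      obtain \<xi> W where W: "\<xi> \<in> perp U" "functional.subspace W" "W \<subseteq> perp U" "closedin T' W" "F = \<xi> +o W"
        using variety[OF F] by blast
      have \<xi>F: "\<xi> \<in> F" using functional.subspace_0[OF W(2)] unfolding W(5) by (auto simp: elt_set_plus_def)
      \<comment> \<open>\<open>\<psi>\<close> and \<open>\<xi>\<close> agree at the common zeros of
        \<open>W\<close>; the closedness of \<open>W\<close> turns this into membership.\<close>
      have "\<psi> - \<xi> \<in> W"
      proof (rule closed_subspace_perp_perp[OF U W(2,3,4)])
        show "\<psi> - \<xi> \<in> perp U" by (rule functional.subspace_diff[OF subspace_perp \<psi>(1) W(1)])
        fix x assume x: "x \<in> topspace T" "\<And>w. w \<in> W \<Longrightarrow> w x = 0"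
        have val: "f x = \<xi> x" if "f \<in> F" for f
        proof -
          have "f - \<xi> \<in> W" using that unfolding W(5) by (rule set_plus_imp_minus)
          from x(2)[OF this] show ?thesis by simp
        qed
        have "f x = g x" if "f \<in> F" "g \<in> F" for f g
          unfolding val[OF that(1)] val[OF that(2)] ..
        with x(1) have "x \<in> S F" unfolding S_def by blast
        then have "x \<in> D {F}" by (auto simp: D_def intro: span_base)
        then have "P x (\<xi> x)"
          unfolding P_def using F \<xi>F W(1) by (intro exI[of _ "{F}"] exI[of _ \<xi>]) auto
        then show "(\<psi> - \<xi>) x = 0" using \<psi>(2) x(1) by simp
      qed
      then show ?thesis unfolding W(5) by (rule set_minus_imp_plus)
    qed
    then show ?thesis by blast
  qed
  then have "linearly_compact fun_smul ?X"
    unfolding linearly_compact_def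
    using dual.linearly_topologized_subtopology[OF linearly_topologized_dual linear_subspace_perp[of U]]
    by blast
  then show ?thesis using linear_subspace_perp by (simp add: linearly_compact_subspace_def)
qed

lemma perp_lc_open: "U \<in> lco \<Longrightarrow> perp U \<in> lc_open_subspaces fun_smul T'"
  using perp_linearly_compact openin_perp by (simp add: lc_open_subspaces_def)

text \<open>Being open, \<open>W\<close> contains some \<open>perp A\<close>; being linearly
  compact, it is spanned by \<open>perp A\<close> and a finite set \<open>B\<close>. The common
  kernel \<open>U\<close> of \<open>B\<close> in \<open>A\<close> is then open, and \<open>W\<close>
  annihilates it. Conversely, a \<open>\<psi>\<close> in \<open>perp U\<close> coincides on
  \<open>A\<close> with a member of \<open>W\<close>, and the difference lies in
  \<open>perp A\<close>, a part of \<open>W\<close>.\<close>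

lemma lc_open_dual_eq_perp:
  assumes W: "W \<in> lc_open_subspaces fun_smul T'"
  obtains U where "U \<in> lco" "W = perp U"
proof -
  interpret dual: top_vec_space fun_smul T' by (rule top_vec_space_dual)
  have W': "functional.subspace W" "W \<subseteq> V'" "openin T' W" "linearly_compact_subspace fun_smul T' W"
    using W by (auto simp: lc_open_subspaces_def linearly_compact_subspace_def linear_subspace_def topspace_dual)
  have "0 \<in> W" using W'(1) by (rule functional.subspace_0)
  then have "\<exists>A\<in>lco. 0 +o perp A \<subseteq> W" using W'(3) unfolding openin_dual_iff by blast
  then obtain A where A: "A \<in> lco" "perp A \<subseteq> W" by auto
  note A' = lcoD[OF A(1)]
  obtain B where "quotient_basis fun_smul W (perp A \<inter> W) B"
    using dual.linearly_compact_subspace_quotient_basis[OF W'(4) subspace_perp openin_perp[OF A(1)]] by blast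
  then have B: "quotient_basis fun_smul W (perp A) B" using A(2) by (simp add: Int_absorb2)
  have WB: "W = functional.span (perp A \<union> B)"
    by (rule functional.quotient_basis_span[OF W'(1) subspace_perp A(2) B])
  have B': "finite B" "B \<subseteq> V'" using B W'(2) by (auto simp: quotient_basis_def)
  define U where "U = A \<inter> (\<Inter>b\<in>B. {x \<in> topspace T. b x \<in> {0}})"
  have UA: "U \<subseteq> A" by (auto simp: U_def)
  have "subspace {x \<in> topspace T. b x \<in> {0}}" if b: "b \<in> B" for b
  proof -
    have lin: "linear_map_on (topspace T) scale (*) b" using CHom_linear b B'(2) by blast
    show ?thesis
      using subspace_topspace linear_map_on_0[OF lin subspace_topspace] linear_map_onD[OF lin]
      by (auto simp: subspace_def)
  qed
  then have sU: "subspace U" unfolding U_def by (intro subspace_inter subspace_Int A'(2))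
  have "openin T {x \<in> topspace T. b x \<in> {0}}" if "b \<in> B" for b
    using that B'(2)
    by (intro openin_continuous_map_preimage[where Y = "discrete_topology UNIV"]) (auto simp: CHom_def)
  \<comment> \<open>For empty \<open>B\<close> the intersection of kernels is \<open>UNIV\<close>
    rather than the carrier, hence the case split.\<close>
  then have oU: "openin T U"
    unfolding U_def using B'(1) A'(4) by (cases "B = {}") (auto intro!: openin_Int openin_INT2)
  have U: "U \<in> lco" by (rule lco_subset[OF A(1) sU oU UA])
  obtain C where C: "finite C" "A = span (U \<union> C)" by (rule lco_quotient_basis[OF A(1) sU oU UA])
  have "W \<subseteq> perp U"
    unfolding WB
  proof (rule functional.span_minimal[OF _ subspace_perp])
    show "perp A \<union> B \<subseteq> perp U"
      using perp_antimono[OF UA] B'(2) by (auto simp: annihilator_def U_def)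
  qed
  moreover have "perp U \<subseteq> W"
  proof
    fix \<psi> assume \<psi>: "\<psi> \<in> perp U"
    have lin: "linear_map_on (span (U \<union> C)) scale (*) \<eta>" if "\<eta> \<in> V'" for \<eta>
      using linear_map_on_subset[OF CHom_linear[OF that] A'(3)] C(2) by simp
    have BW: "B \<subseteq> W" using B by (simp add: quotient_basis_def)
    have "\<exists>w\<in>W. \<forall>x\<in>span (U \<union> C). w x = \<psi> x"
    proof (rule functional_eq_on_finite_extension[OF C(1) W'(1)])
      fix x assume x: "x \<in> span (U \<union> C)" "\<And>w. w \<in> W \<Longrightarrow> w x = 0"
      then have "x \<in> A" using C(2) by simp
      moreover have "b x \<in> {0}" if "b \<in> B" for b using x(2)[of b] that BW by blast
      ultimately have "x \<in> U" using A'(3) unfolding U_def by blast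
      then show "\<psi> x = 0" using perpD(2)[OF \<psi>] by blast
    qed (use lin W'(2) \<open>W \<subseteq> perp U\<close> perpD[OF \<psi>] perpD(2) in blast)+
    then obtain w where w: "w \<in> W" "\<And>x. x \<in> A \<Longrightarrow> w x = \<psi> x" using C(2) by blast
    have "\<psi> - w \<in> V'" using perpD(1)[OF \<psi>] w(1) W'(2) functional.subspace_diff[OF subspace_CHom] by blast
    then have "\<psi> - w \<in> perp A" using w(2) by (auto simp: annihilator_def)
    then have "(\<psi> - w) + w \<in> W" using A(2) w(1) by (intro functional.subspace_add[OF W'(1)]) auto
    then show "\<psi> \<in> W" by simp
  qed
  ultimately show ?thesis using that[OF U] by blast
qed

lemma lc_open_subspaces_dual: "lc_open_subspaces fun_smul T' = perp ` lco"
  using perp_lc_open lc_open_dual_eq_perp by blast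

text \<open>The content is in the inclusion into the sum. If \<open>\<psi>\<close> vanishes on
  \<open>A \<inter> B\<close>, then \<open>a + b \<mapsto> \<psi> b\<close> is well defined on
  \<open>A + B\<close> and 0 on \<open>A\<close>. An extension \<open>\<xi>\<close> lies in
  \<open>perp A\<close> because \<open>A\<close> is open, and \<open>\<psi> - \<xi>\<close> lies in
  \<open>perp B\<close>.\<close>

lemma perp_Int:
  assumes A: "subspace A" "openin T A" and B: "subspace B" "openin T B"
  shows "perp (A \<inter> B) = perp A + perp B"
proof
  show "perp A + perp B \<subseteq> perp (A \<inter> B)"
    using functional.subspace_add[OF subspace_CHom]
    by (auto simp: annihilator_def elim!: set_plus_elim)
  note AT = openin_subset[OF A(2)] and BT = openin_subset[OF B(2)]
  show "perp (A \<inter> B) \<subseteq> perp A + perp B"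
  proof
    fix \<psi> assume \<psi>: "\<psi> \<in> perp (A \<inter> B)"
    note lin = CHom_linear[OF perpD(1)[OF \<psi>]]
    define P where "P x c \<longleftrightarrow> (\<exists>a\<in>A. \<exists>b\<in>B. x = a + b \<and> c = \<psi> b)" for x c
    obtain \<xi> where \<xi>: "\<xi> \<in> perp A" "\<And>x c. P x c \<Longrightarrow> x \<in> topspace T \<Longrightarrow> \<xi> x = c"
    proof (rule perp_extend[OF A(2) subspace_0[OF A(1)], of P])
      fix x y c d assume "P x c" "P y d"
      then obtain a b a' b' where *: "a \<in> A" "b \<in> B" "x = a + b" "c = \<psi> b"
        "a' \<in> A" "b' \<in> B" "y = a' + b'" "d = \<psi> b'" unfolding P_def by blast
      have "c + d = \<psi> (b + b')"
        using *(4,8) linear_map_onD(1)[OF lin subsetD[OF BT *(2)] subsetD[OF BT *(6)]] by simp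
      moreover have "x + y = (a + a') + (b + b')" using * by (simp add: algebra_simps)
      moreover have "a + a' \<in> A" "b + b' \<in> B" using * A B by (auto intro: subspace_add)
      ultimately show "P (x + y) (c + d)" unfolding P_def by blast
    next
      fix k x c assume "P x c"
      then obtain a b where *: "a \<in> A" "b \<in> B" "x = a + b" "c = \<psi> b" unfolding P_def by blast
      have "k * c = \<psi> (scale k b)" using *(4) linear_map_onD(2)[OF lin subsetD[OF BT *(2)]] by simp
      moreover have "scale k x = scale k a + scale k b" using * by (simp add: scale_right_distrib)
      moreover have "scale k a \<in> A" "scale k b \<in> B" using * A B by (auto intro: subspace_scale)
      ultimately show "P (scale k x) (k * c)" unfolding P_def by blast
    next
      fix c assume "P 0 c"
      then obtain a b where *: "a \<in> A" "b \<in> B" "a + b = 0" "c = \<psi> b" unfolding P_def by metis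
      have "b = - a" using *(3) by (simp add: eq_neg_iff_add_eq_0 add.commute)
      then have "b \<in> A \<inter> B" using * subspace_neg[OF A(1)] by auto
      then show "c = 0" using *(4) perpD(2)[OF \<psi>] by simp
    next
      fix a assume "a \<in> A"
      moreover have "\<psi> 0 = 0" using lin subspace_topspace by (rule linear_map_on_0)
      ultimately show "P a 0" unfolding P_def using subspace_0[OF B(1)] by (intro bexI[of _ a] bexI[of _ 0]) auto
    next
      fix \<xi> assume "\<xi> \<in> perp A" "\<And>x c. P x c \<Longrightarrow> x \<in> topspace T \<Longrightarrow> \<xi> x = c"
      then show thesis by (rule that)
    qed
    have "\<xi> b = \<psi> b" if "b \<in> B" for b
    proof -
      have "P b (\<psi> b)" unfolding P_def using that subspace_0[OF A(1)] by (intro bexI[of _ 0] bexI[of _ b]) auto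
      then show ?thesis using \<xi>(2) that BT by blast
    qed
    moreover have "\<psi> - \<xi> \<in> V'"
      using perpD(1)[OF \<psi>] perpD(1)[OF \<xi>(1)] by (rule functional.subspace_diff[OF subspace_CHom])
    ultimately have "\<psi> - \<xi> \<in> perp B" by (auto simp: annihilator_def)
    with \<xi>(1) have "\<xi> + (\<psi> - \<xi>) \<in> perp A + perp B" by (rule set_plus_intro)
    then show "\<psi> \<in> perp A + perp B" by simp
  qed
qed

section \<open>The dual endomorphism and its powers\<close>

lemma dual_endomorphism_CHom:
  assumes f: "continuous_endomorphism scale T f" and \<xi>: "\<xi> \<in> V'"
  shows "dual_endomorphism T f \<xi> \<in> V'"
proof -
  have cf: "continuous_map T T f" and lf: "linear_map_on (topspace T) scale scale f"
    using f by (auto simp: continuous_endomorphism_def)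
  have fT: "f x \<in> topspace T" if "x \<in> topspace T" for x
    using continuous_map_funspace[OF cf] that by auto
  obtain U where U: "U \<in> lco" "\<And>u. u \<in> U \<Longrightarrow> \<xi> u = 0" using \<xi> by (auto simp: CHom_iff)
  have f0: "f 0 = 0" using linear_map_onD(2)[OF lf subspace_0[OF subspace_topspace], of 0] by simp
  have "openin T {x \<in> topspace T. f x \<in> U}"
    using cf lcoD(4)[OF U(1)] by (rule openin_continuous_map_preimage)
  then obtain A where A: "A \<in> lco" "A \<subseteq> {x \<in> topspace T. f x \<in> U}"
    using lcoD(5)[OF U(1)] f0 subspace_0[OF subspace_topspace] by (elim lco_basis) auto
  have "\<forall>a\<in>A. dual_endomorphism T f \<xi> a = 0"
    using A(2) U(2) by (auto simp: dual_endomorphism_def)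
  moreover have "linear_map_on (topspace T) scale (*) (dual_endomorphism T f \<xi>)"
    using lf fT CHom_linear[OF \<xi>] subspace_topspace
    by (auto simp: linear_map_on_def dual_endomorphism_def subspace_add subspace_scale)
  moreover have "\<forall>x. x \<notin> topspace T \<longrightarrow> dual_endomorphism T f \<xi> x = 0"
    by (simp add: dual_endomorphism_def)
  ultimately show ?thesis unfolding CHom_iff using A(1) by blast
qed

lemma subspace_preimage:
  assumes f: "continuous_endomorphism scale T f" and U: "subspace U"
  shows "subspace {x \<in> topspace T. f x \<in> U}"
proof -
  have lf: "linear_map_on (topspace T) scale scale f"
    using f by (auto simp: continuous_endomorphism_def)
  have f0: "f 0 = 0" using linear_map_onD(2)[OF lf subspace_0[OF subspace_topspace], of 0] by simp
  show ?thesis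
    using U subspace_topspace linear_map_onD[OF lf] f0 by (auto simp: subspace_def)
qed

text \<open>A \<open>\<psi>\<close> that vanishes on the preimage of \<open>U\<close> factors
  through \<open>f\<close> modulo \<open>U\<close>: if \<open>f v + u = 0\<close> with
  \<open>u\<close> in \<open>U\<close>, then \<open>f v\<close> lies in \<open>U\<close> and
  \<open>\<psi> v = 0\<close>. So \<open>f v + u \<mapsto> \<psi> v\<close> is a partial functional,
  0 on the open \<open>U\<close>, and its extension is sent to \<open>\<psi>\<close> by the dual
  endomorphism.\<close>

lemma perp_preimage:
  assumes f: "continuous_endomorphism scale T f" and U: "subspace U" "openin T U"
  shows "perp {x \<in> topspace T. f x \<in> U} = dual_endomorphism T f ` perp U"
proof
  have cf: "continuous_map T T f" and lf: "linear_map_on (topspace T) scale scale f"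
    using f by (auto simp: continuous_endomorphism_def)
  have fT: "f x \<in> topspace T" if "x \<in> topspace T" for x
    using continuous_map_funspace[OF cf] that by auto
  show "dual_endomorphism T f ` perp U \<subseteq> perp {x \<in> topspace T. f x \<in> U}"
    using dual_endomorphism_CHom[OF f] by (auto simp: annihilator_def dual_endomorphism_def)
  show "perp {x \<in> topspace T. f x \<in> U} \<subseteq> dual_endomorphism T f ` perp U"
  proof
    fix \<psi> assume \<psi>: "\<psi> \<in> perp {x \<in> topspace T. f x \<in> U}"
    note lin = CHom_linear[OF perpD(1)[OF \<psi>]]
    define P where "P x c \<longleftrightarrow> (\<exists>v\<in>topspace T. \<exists>u\<in>U. x = f v + u \<and> c = \<psi> v)" for x c
    obtain \<xi> where \<xi>: "\<xi> \<in> perp U" "\<And>x c. P x c \<Longrightarrow> x \<in> topspace T \<Longrightarrow> \<xi> x = c"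
    proof (rule perp_extend[OF U(2) subspace_0[OF U(1)], of P])
      fix x y c d assume "P x c" "P y d"
      then obtain a b a' b' where *: "a \<in> topspace T" "b \<in> U" "x = f a + b" "c = \<psi> a"
        "a' \<in> topspace T" "b' \<in> U" "y = f a' + b'" "d = \<psi> a'" unfolding P_def by blast
      have "c + d = \<psi> (a + a')" using * linear_map_onD(1)[OF lin, of a a'] by auto
      moreover have "x + y = f (a + a') + (b + b')"
        using * linear_map_onD(1)[OF lf, of a a'] by (simp add: algebra_simps)
      moreover have "a + a' \<in> topspace T" "b + b' \<in> U"
        using * subspace_topspace U by (auto intro: subspace_add)
      ultimately show "P (x + y) (c + d)" unfolding P_def by blast
    next
      fix k x c assume "P x c"
      then obtain a b where *: "a \<in> topspace T" "b \<in> U" "x = f a + b" "c = \<psi> a" unfolding P_def by blast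
      have "k * c = \<psi> (scale k a)" using * linear_map_onD(2)[OF lin, of a] by auto
      moreover have "scale k x = f (scale k a) + scale k b"
        using * linear_map_onD(2)[OF lf, of a] by (simp add: scale_right_distrib)
      moreover have "scale k a \<in> topspace T" "scale k b \<in> U"
        using * subspace_topspace U by (auto intro: subspace_scale)
      ultimately show "P (scale k x) (k * c)" unfolding P_def by blast
    next
      fix c assume "P 0 c"
      then obtain a b where *: "a \<in> topspace T" "b \<in> U" "f a + b = 0" "c = \<psi> a" unfolding P_def by metis
      have "f a = - b" using *(3) by (simp add: eq_neg_iff_add_eq_0)
      then have "f a \<in> U" using * subspace_neg[OF U(1)] by auto
      then show "c = 0" using *(1,4) perpD(2)[OF \<psi>, of a] by simp
    next
      fix u assume "u \<in> U"
      moreover have "\<psi> 0 = 0" using lin subspace_topspace by (rule linear_map_on_0)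
      moreover have "f 0 = 0"
        using linear_map_onD(2)[OF lf subspace_0[OF subspace_topspace], of 0] by simp
      ultimately show "P u 0"
        unfolding P_def using subspace_0[OF subspace_topspace] by (intro bexI[of _ 0] bexI[of _ u]) auto
    next
      fix \<xi> assume "\<xi> \<in> perp U" "\<And>x c. P x c \<Longrightarrow> x \<in> topspace T \<Longrightarrow> \<xi> x = c"
      then show thesis by (rule that)
    qed
    have "\<psi> x = dual_endomorphism T f \<xi> x" for x
    proof (cases "x \<in> topspace T")
      case True
      have "P (f x) (\<psi> x)"
        unfolding P_def using True subspace_0[OF U(1)] by (intro bexI[of _ x] bexI[of _ 0]) auto
      then show ?thesis using \<xi>(2) fT[OF True] True by (simp add: dual_endomorphism_def)
    next
      case False
      then show ?thesis using perpD(1)[OF \<psi>] by (auto simp: CHom_iff dual_endomorphism_def)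
    qed
    then show "\<psi> \<in> dual_endomorphism T f ` perp U" using \<xi>(1) by blast
  qed
qed

lemma continuous_endomorphism_funpow:
  assumes "continuous_endomorphism scale T f"
  shows "continuous_endomorphism scale T (f ^^ n)"
proof (induction n)
  case 0
  then show ?case by (simp add: continuous_endomorphism_def linear_map_on_def)
next
  case (Suc n)
  have c: "continuous_map T T (f ^^ n)" "continuous_map T T f"
    using Suc assms by (auto simp: continuous_endomorphism_def)
  then have "continuous_map T T (f ^^ Suc n)" by (auto intro: continuous_map_compose)
  moreover have "(f ^^ n) x \<in> topspace T" if "x \<in> topspace T" for x
    using continuous_map_funspace[OF c(1)] that by auto
  ultimately show ?case
    using Suc assms by (auto simp: continuous_endomorphism_def linear_map_on_def o_def)
qed

lemma dual_endomorphism_funpow: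
  assumes f: "continuous_endomorphism scale T f" and \<xi>: "\<xi> \<in> V'"
  shows "(dual_endomorphism T f ^^ n) \<xi> = dual_endomorphism T (f ^^ n) \<xi>"
proof (induction n)
  case 0
  \<comment> \<open>For \<open>n = 0\<close> the right-hand side cuts \<open>\<xi>\<close> off
    outside the carrier, where it vanishes anyway.\<close>
  then show ?case using \<xi> by (auto simp: dual_endomorphism_def CHom_iff fun_eq_iff)
next
  case (Suc n)
  have "f x \<in> topspace T" if "x \<in> topspace T" for x
    using f that continuous_map_funspace[of T T f] by (auto simp: continuous_endomorphism_def)
  then show ?case
    using Suc by (auto simp: dual_endomorphism_def fun_eq_iff funpow_swap1)
qed

section \<open>Trajectories, dimensions and entropy\<close>

lemma cotrajectory_Suc:
  "cotrajectory T f U (Suc n) = cotrajectory T f U n \<inter> {x \<in> topspace T. (f ^^ n) x \<in> U}"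
  by (auto simp: cotrajectory_def less_Suc_eq)

lemma cotrajectory_open_subspace:
  assumes f: "continuous_endomorphism scale T f" and U: "subspace U" "openin T U"
  shows "subspace (cotrajectory T f U n) \<and> openin T (cotrajectory T f U n)"
proof (induction n)
  case 0
  then show ?case using subspace_topspace by (simp add: cotrajectory_def)
next
  case (Suc n)
  note fn = continuous_endomorphism_funpow[OF f, of n]
  have "openin T {x \<in> topspace T. (f ^^ n) x \<in> U}"
    using fn U(2) by (intro openin_continuous_map_preimage) (auto simp: continuous_endomorphism_def)
  with Suc show ?case
    unfolding cotrajectory_Suc using subspace_preimage[OF fn U(1)] by (auto intro: subspace_inter)
qed

lemma perp_cotrajectory:
  assumes f: "continuous_endomorphism scale T f" and U: "subspace U" "openin T U"
  shows "perp (cotrajectory T f U n) = trajectory (dual_endomorphism T f) (perp U) n"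
proof (induction n)
  case 0
  \<comment> \<open>The cotrajectory of length 0 is the whole carrier; its annihilator
    \<open>{0}\<close> is the empty Minkowski sum.\<close>
  then show ?case by (simp add: cotrajectory_def trajectory_def perp_topspace set_zero)
next
  case (Suc n)
  note fn = continuous_endomorphism_funpow[OF f, of n]
  have o: "openin T {x \<in> topspace T. (f ^^ n) x \<in> U}"
    using fn U(2) by (intro openin_continuous_map_preimage) (auto simp: continuous_endomorphism_def)
  have "dual_endomorphism T (f ^^ n) ` perp U = (dual_endomorphism T f ^^ n) ` perp U"
    using dual_endomorphism_funpow[OF f] perpD(1) by (intro image_cong) auto
  then have "perp (cotrajectory T f U (Suc n)) =
      perp (cotrajectory T f U n) + (dual_endomorphism T f ^^ n) ` perp U"
    unfolding cotrajectory_Suc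
    using perp_Int[OF _ _ subspace_preimage[OF fn U(1)] o] cotrajectory_open_subspace[OF f U]
      perp_preimage[OF fn U] by simp
  with Suc show ?case by (simp add: trajectory_def)
qed

text \<open>The functionals dual to a basis of \<open>A/C\<close> form a basis of \<open>perp C / perp A\<close>.\<close>

lemma quotient_dim_perp:
  assumes A: "A \<in> lco" and C: "subspace C" "openin T C" "C \<subseteq> A"
  shows "quotient_dim fun_smul (perp C) (perp A) = quotient_dim scale A C"
proof -
  note A' = lcoD[OF A]
  obtain B where B: "quotient_basis scale A C B" "finite B" "A = span (C \<union> B)"
    by (rule lco_quotient_basis[OF A C])
  have BA: "B \<subseteq> A" using B(1) by (simp add: quotient_basis_def)
  have indep: "c b = 0" if "(\<Sum>b\<in>B. scale (c b) b) \<in> C" "b \<in> B" for c b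
    using B(1) that by (auto simp: quotient_basis_iff[OF A'(2) C(1)])
  have "\<exists>\<xi>\<in>perp C. \<forall>b'\<in>B. \<xi> b' = (if b' = b then 1 else 0)" if b: "b \<in> B" for b
  proof -
    \<comment> \<open>The coordinate at \<open>b\<close> modulo \<open>C\<close>; by
      \<open>indep\<close> its only value at 0 is 0.\<close>
    define P where "P x a \<longleftrightarrow> (\<exists>c. \<exists>w\<in>C. x = (\<Sum>b\<in>B. scale (c b) b) + w \<and> a = c b)" for x a
    obtain \<xi> where \<xi>: "\<xi> \<in> perp C" "\<And>x c. P x c \<Longrightarrow> x \<in> topspace T \<Longrightarrow> \<xi> x = c"
    proof (rule perp_extend[OF C(2) subspace_0[OF C(1)], of P])
      fix x y a a' assume "P x a" "P y a'"
      then obtain c w c' w' where *: "w \<in> C" "x = (\<Sum>b\<in>B. scale (c b) b) + w" "a = c b"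
        "w' \<in> C" "y = (\<Sum>b\<in>B. scale (c' b) b) + w'" "a' = c' b" unfolding P_def by blast
      have "x + y = (\<Sum>b\<in>B. scale (c b + c' b) b) + (w + w')"
        using * by (simp add: scale_left_distrib sum.distrib algebra_simps)
      moreover have "w + w' \<in> C" using *(1,4) by (rule subspace_add[OF C(1)])
      ultimately show "P (x + y) (a + a')"
        unfolding P_def *(3,6) by (intro exI[of _ "\<lambda>b. c b + c' b"] bexI[of _ "w + w'"]) auto
    next
      fix k x a assume "P x a"
      then obtain c w where *: "w \<in> C" "x = (\<Sum>b\<in>B. scale (c b) b) + w" "a = c b"
        unfolding P_def by blast
      have "scale k x = (\<Sum>b\<in>B. scale (k * c b) b) + scale k w"
        using * by (simp add: scale_right_distrib scale_sum_right)
      moreover have "scale k w \<in> C" using *(1) by (rule subspace_scale[OF C(1)])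
      ultimately show "P (scale k x) (k * a)"
        unfolding P_def *(3) by (intro exI[of _ "\<lambda>b. k * c b"] bexI[of _ "scale k w"]) auto
    next
      fix a assume "P 0 a"
      then obtain c w where *: "w \<in> C" "(\<Sum>b\<in>B. scale (c b) b) + w = 0" "a = c b"
        unfolding P_def by metis
      have "(\<Sum>b\<in>B. scale (c b) b) = - w" using *(2) by (simp add: eq_neg_iff_add_eq_0)
      then have "(\<Sum>b\<in>B. scale (c b) b) \<in> C" using *(1) subspace_neg[OF C(1)] by simp
      then show "a = 0" unfolding *(3) using b by (rule indep)
    next
      fix w assume "w \<in> C"
      then show "P w 0" unfolding P_def by (intro exI[of _ "\<lambda>_. 0"] bexI[of _ w]) auto
    next
      fix \<xi> assume "\<xi> \<in> perp C" "\<And>x c. P x c \<Longrightarrow> x \<in> topspace T \<Longrightarrow> \<xi> x = c"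
      then show thesis by (rule that)
    qed
    have "\<xi> b' = (if b' = b then 1 else 0)" if b': "b' \<in> B" for b'
    proof -
      have "(\<Sum>d\<in>B. scale (if d = b' then 1 else 0) d) = (\<Sum>d\<in>B. if d = b' then d else 0)"
        by (rule sum.cong) auto
      also have "\<dots> = b'" using B(2) b' by simp
      finally have "P b' (if b = b' then 1 else 0)"
        unfolding P_def using subspace_0[OF C(1)]
        by (intro exI[of _ "\<lambda>d. if d = b' then 1 else 0"] bexI[of _ 0]) auto
      moreover have "b' \<in> topspace T" using b' BA A'(3) by blast
      ultimately show ?thesis using \<xi>(2) by auto
    qed
    with \<xi>(1) show ?thesis by blast
  qed
  then obtain \<beta> where \<beta>: "\<And>b. b \<in> B \<Longrightarrow> \<beta> b \<in> perp C"
    "\<And>b b'. b \<in> B \<Longrightarrow> b' \<in> B \<Longrightarrow> \<beta> b b' = (if b' = b then 1 else 0)" by metis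
  have inj: "inj_on \<beta> B"
  proof (rule inj_onI)
    fix b b' assume "b \<in> B" "b' \<in> B" "\<beta> b = \<beta> b'"
    then show "b = b'" using \<beta>(2)[of b b] \<beta>(2)[of b' b] by (metis one_neq_zero)
  qed
  have eval: "(\<Sum>b\<in>B. fun_smul (c b) (\<beta> b)) b' = c b'" if "b' \<in> B" for c b'
  proof -
    have "(\<Sum>b\<in>B. fun_smul (c b) (\<beta> b)) b' = (\<Sum>b\<in>B. if b = b' then c b else 0)"
      unfolding fun_sum_apply using \<beta>(2) that by (intro sum.cong) (auto simp: fun_smul_def)
    then show ?thesis using B(2) that by simp
  qed
  have reindex: "(\<Sum>\<eta>\<in>\<beta> ` B. fun_smul (c \<eta>) \<eta>) = (\<Sum>b\<in>B. fun_smul (c (\<beta> b)) (\<beta> b))" for c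
    using inj by (simp add: sum.reindex)
  have "quotient_basis fun_smul (perp C) (perp A) (\<beta> ` B)"
    unfolding functional.quotient_basis_iff[OF subspace_perp subspace_perp]
  proof (intro conjI ballI allI impI)
    show "finite (\<beta> ` B)" using B(2) by simp
    show "\<beta> ` B \<subseteq> perp C" using \<beta>(1) by blast
  next
    fix \<psi> assume \<psi>: "\<psi> \<in> perp C"
    \<comment> \<open>Expansion in the dual basis: the coefficient of \<open>\<beta> b\<close> is
      the value at \<open>b\<close>, so \<open>\<theta>\<close> agrees with \<open>\<psi>\<close> on
      \<open>B\<close>, and both vanish on \<open>C\<close>.\<close>
    define \<theta> where "\<theta> = (\<Sum>b\<in>B. fun_smul (\<psi> b) (\<beta> b))"
    have \<theta>: "\<theta> \<in> perp C"
      unfolding \<theta>_def using \<beta>(1)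
      by (intro functional.subspace_sum functional.subspace_scale subspace_perp) auto
    have "\<psi> x = \<theta> x" if x: "x \<in> A" for x
    proof (rule linear_map_on_eq_span[where S = "C \<union> B"])
      show "x \<in> span (C \<union> B)" using x B(3) by simp
      show "C \<union> B \<subseteq> topspace T" using BA C(3) A'(3) by blast
      fix y assume "y \<in> C \<union> B"
      then show "\<psi> y = \<theta> y"
        using perpD(2)[OF \<psi>, of y] perpD(2)[OF \<theta>, of y] eval[of y \<psi>] by (auto simp: \<theta>_def)
    qed (use CHom_linear perpD(1)[OF \<psi>] perpD(1)[OF \<theta>] subspace_topspace in auto)
    moreover have "\<psi> - \<theta> \<in> V'"
      using perpD(1)[OF \<psi>] perpD(1)[OF \<theta>] by (rule functional.subspace_diff[OF subspace_CHom])
    ultimately have "\<psi> - \<theta> \<in> perp A" by (auto simp: annihilator_def)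
    moreover have "\<theta> = (\<Sum>\<eta>\<in>\<beta> ` B. fun_smul (\<psi> (inv_into B \<beta> \<eta>)) \<eta>)"
      unfolding reindex \<theta>_def using inj by (intro sum.cong) auto
    ultimately show "\<exists>c. \<psi> - (\<Sum>\<eta>\<in>\<beta> ` B. fun_smul (c \<eta>) \<eta>) \<in> perp A" by metis
  next
    fix c \<eta> assume s: "(\<Sum>\<eta>\<in>\<beta> ` B. fun_smul (c \<eta>) \<eta>) \<in> perp A" and "\<eta> \<in> \<beta> ` B"
    then obtain b where b: "b \<in> B" "\<eta> = \<beta> b" by blast
    from perpD(2)[OF s, of b] show "c \<eta> = 0"
      unfolding reindex using eval[OF b(1), of "\<lambda>b. c (\<beta> b)"] b BA by auto
  qed
  then have "quotient_dim fun_smul (perp C) (perp A) = enat (card (\<beta> ` B))"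
    by (rule functional.quotient_dim_eq[OF subspace_perp subspace_perp])
  also have "\<dots> = quotient_dim scale A C"
    using quotient_dim_eq[OF A'(2) C(1) B(1)] inj by (simp add: card_image)
  finally show ?thesis .
qed

text \<open>The terms are compared from \<open>n = 1\<close> on, since the cotrajectory of length 0
  is the whole carrier and need not lie in \<open>U\<close>. As \<open>lim\<close> is a definite
  description, it is enough that both sequences tend to the same points, and this depends only on
  their eventual values.\<close>

lemma top_entropy_at_eq_alg_entropy_at:
  assumes f: "continuous_endomorphism scale T f" and U: "U \<in> lco"
  shows "top_entropy_at scale T f U = alg_entropy_at fun_smul (dual_endomorphism T f) (perp U)"
proof -
  note U' = lcoD[OF U]
  have eq: "quotient_dim scale U (cotrajectory T f U n) =
      quotient_dim fun_smul (trajectory (dual_endomorphism T f) (perp U) n) (perp U)" if "n \<ge> 1" for n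
  proof -
    have "cotrajectory T f U n \<subseteq> U" using that by (auto simp: cotrajectory_def dest: INT_D[of _ _ _ 0])
    with cotrajectory_open_subspace[OF f U'(2,4), of n] show ?thesis
      unfolding perp_cotrajectory[OF f U'(2,4), symmetric]
      by (intro quotient_dim_perp[OF U, symmetric]) auto
  qed
  show ?thesis
    unfolding top_entropy_at_def alg_entropy_at_def lim_def
    by (intro arg_cong[where f = The] ext tendsto_cong eventually_sequentiallyI[of 1])
      (simp add: eq)
qed

end

theorem theorem1p3:
  fixes smul :: "'k::field \<Rightarrow> 'v::ab_group_add \<Rightarrow> 'v"
    and T :: "'v topology"
    and \<phi> :: "'v \<Rightarrow> 'v"
  assumes "locally_linearly_compact smul T"
    and "continuous_endomorphism smul T \<phi>"
  shows "top_entropy smul T \<phi> =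
         alg_entropy fun_smul (dual_topology smul T) (dual_endomorphism T \<phi>)"
proof -
  have tvs: "topological_vec_space smul T"
    using assms(1) by (simp add: locally_linearly_compact_def)
  then interpret vector_space smul by (simp add: topological_vec_space_def)
  interpret loc_lin_compact smul T
    using tvs assms(1) by unfold_locales
  \<comment> \<open>By \<open>lc_open_subspaces_dual\<close> the supremum over the dual becomes one
    over \<open>U\<close>, along \<open>U \<mapsto> perp U\<close>.\<close>
  show ?thesis
    unfolding top_entropy_def alg_entropy_def lc_open_subspaces_dual image_image
    using top_entropy_at_eq_alg_entropy_at[OF assms(2)] by (intro SUP_cong) auto
qed

end
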